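(* There is a uniformly computably enumerable family $\mathcal L$ of subsets of $\mathbb N$ that is TxtFex$^*_2$-learnable but is not TxtFext$^*_*$-learnable. In particular, TxtFex$^*_* \neq$ TxtFext$^*_*$.
   Context: Fix an acceptable numbering $(W_e)_{e\in\mathbb N}$ of the computably enumerable (c.e.) subsets of $\mathbb N$. A learning machine (learner) is a computable function $M:\mathbb N^{<\mathbb N}\to\mathbb N$ from finite strings of natural numbers to natural numbers (outputs are read as indices of c.e. sets). An enumeration (text) $f$ of a set $A$ is an infinite sequence $f:\mathbb N\to\mathbb N$ with content$(f)=\{f(n):n\in\mathbb N\}=A$; $f\upharpoonright n$ is its initial segment of length $n$. For sets $A,B$, write $A=^*B$ if their symmetric difference is finite and $A=^iB$ (for $i\in\mathbb N$) if their symmetric difference has at most $i$ elements; $=^*$ corresponds to $i=*$. Let $i,j\in\mathbb N\cup\{*\}$. TxtFex$^i_j$: $M$ TxtFex$^i_j$-identifies an enumeration $f$ iff there is a finite set $S$ with $|S|\le j$ (no bound if $j=*$) such that for all but finitely many $n$, $M(f\upharpoonright n)\in S$, and for every $a\in S$, $W_a=^i\mathrm{content}(f)$. $M$ TxtFex$^i_j$-learns a c.e. set $A$ iff it TxtFex$^i_j$-identifies every enumeration of $A$; it TxtFex$^i_j$-learns a family iff it TxtFex$^i_j$-learns every member; a family is TxtFex$^i_j$-learnable (in TxtFex$^i_j$) iff some learning machine TxtFex$^i_j$-learns it. TxtFext$^i_j$: identical, except the identification condition is that there is a finite set $S$ with $|S|\le j$ such that for all but finitely many $n$, $M(f\upharpoonright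 n)\in S$, and for all $a,b\in S$, $W_a=W_b=^i\mathrm{content}(f)$ (all hypotheses in $S$ index the same set, which is an $i$-variant of the content). A family $\mathcal L$ of sets is uniformly c.e. if there is a computable $g$ with $\mathcal L=\{W_{g(k)}:k\in\mathbb N\}$. *)

theory Defs
  imports Main "HOL-Library.Nat_Bijection" "HOL-Library.Extended_Nat"
begin

section \<open>Computable functions and computably enumerable sets\<close>

text \<open>
  Kleene's \<open>\<mu>\<close>-recursive functions. Arities are not tracked in the syntax: a program
  denotes a partial function on argument lists, undefined on lists of an unsuitable length.
\<close>

datatype recf =
    Zero
  | Succ
  | Proj nat
  | Comp recf "recf list"
  | PrimRec recf recf
  | Mu recf

inductive rec_eval :: "recf \<Rightarrow> nat list \<Rightarrow> nat \<Rightarrow> bool" where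
  Zero: "rec_eval Zero xs 0"
| Succ: "rec_eval Succ [x] (Suc x)"
| Proj: "i < length xs \<Longrightarrow> rec_eval (Proj i) xs (xs ! i)"
| Comp: "list_all2 (\<lambda>g y. rec_eval g xs y) gs ys \<Longrightarrow> rec_eval f ys z
    \<Longrightarrow> rec_eval (Comp f gs) xs z"
| PrimRec_0: "rec_eval f xs y \<Longrightarrow> rec_eval (PrimRec f g) (0 # xs) y"
| PrimRec_Suc: "rec_eval (PrimRec f g) (n # xs) r \<Longrightarrow> rec_eval g (n # r # xs) y
    \<Longrightarrow> rec_eval (PrimRec f g) (Suc n # xs) y"
| Mu: "rec_eval f (n # xs) 0 \<Longrightarrow> (\<And>m. m < n \<Longrightarrow> \<exists>k. rec_eval f (m # xs) (Suc k))
    \<Longrightarrow> rec_eval (Mu f) xs n"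

inductive_cases rec_eval_ZeroE: "rec_eval Zero xs y"
inductive_cases rec_eval_SuccE: "rec_eval Succ xs y"
inductive_cases rec_eval_ProjE: "rec_eval (Proj i) xs y"
inductive_cases rec_eval_CompE: "rec_eval (Comp f gs) xs y"
inductive_cases rec_eval_PrimRec_0E: "rec_eval (PrimRec f g) (0 # xs) y"
inductive_cases rec_eval_PrimRec_SucE: "rec_eval (PrimRec f g) (Suc n # xs) y"
inductive_cases rec_eval_MuE: "rec_eval (Mu f) xs y"

lemma rec_eval_deterministic:
  "rec_eval p xs y \<Longrightarrow> rec_eval p xs z \<Longrightarrow> y = z"
proof (induction arbitrary: z rule: rec_eval.induct)
  case (Zero xs)
  then show ?case by (rule rec_eval_ZeroE) simp
next
  case (Succ x)
  then show ?case by (rule rec_eval_SuccE) simp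
next
  case (Proj i xs)
  from Proj.prems show ?case by (rule rec_eval_ProjE) simp
next
  case (Comp xs gs ys f y)
  from Comp.prems obtain ys' where ys': "list_all2 (\<lambda>g y. rec_eval g xs y) gs ys'"
    and f: "rec_eval f ys' z"
    by (rule rec_eval_CompE)
  have "ys = ys'"
  proof (rule nth_equalityI)
    show "length ys = length ys'"
      using list_all2_lengthD[OF Comp.IH(1)] list_all2_lengthD[OF ys'] by simp
    fix i assume "i < length ys"
    then show "ys ! i = ys' ! i"
      using list_all2_nthD2[OF Comp.IH(1)] list_all2_nthD[OF ys'] list_all2_lengthD[OF Comp.IH(1)]
      by simp
  qed
  with f show ?case using Comp.IH(2) by blast
next
  case (PrimRec_0 f xs y g)
  from PrimRec_0.prems show ?case by (rule rec_eval_PrimRec_0E) (rule PrimRec_0.IH)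
next
  case (PrimRec_Suc f g n xs r y)
  from PrimRec_Suc.prems obtain r' where "rec_eval (PrimRec f g) (n # xs) r'"
    and "rec_eval g (n # r' # xs) z"
    by (rule rec_eval_PrimRec_SucE)
  with PrimRec_Suc.IH(1)[of r'] PrimRec_Suc.IH(2)[of z] show ?case by simp
next
  case (Mu f n xs)
  from Mu.prems have z: "rec_eval f (z # xs) 0"
    "\<And>m. m < z \<Longrightarrow> \<exists>k. rec_eval f (m # xs) (Suc k)"
    by (auto elim: rec_eval_MuE)
  show ?case
  proof (cases n z rule: linorder_cases)
    case less
    then obtain k where "rec_eval f (n # xs) (Suc k)" using z(2) by blast
    from Mu.IH(1)[OF this] show ?thesis by simp
  next
    case greater
    then obtain k where "\<forall>y. rec_eval f (z # xs) y \<longrightarrow> Suc k = y" using Mu.IH(2) by blast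
    with z(1) show ?thesis by blast
  qed
qed

definition computable :: "(nat \<Rightarrow> nat) \<Rightarrow> bool" where
  "computable f \<longleftrightarrow> (\<exists>p. \<forall>x. rec_eval p [x] (f x))"

definition ce :: "nat set \<Rightarrow> bool" where
  "ce A \<longleftrightarrow> A = {} \<or> (\<exists>f. computable f \<and> A = range f)"


section \<open>Acceptable numberings\<close>

definition uniformly_ce_seq :: "(nat \<Rightarrow> nat set) \<Rightarrow> bool" where
  "uniformly_ce_seq V \<longleftrightarrow> ce {prod_encode (e, x) | e x. x \<in> V e}"

text \<open>
  A numbering of the c.e. sets is acceptable if it is itself uniformly c.e. and every uniformly
  c.e. sequence of sets can be translated into it computably.
\<close>

definition acceptable_numbering :: "(nat \<Rightarrow> nat set) \<Rightarrow> bool" where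
  "acceptable_numbering W \<longleftrightarrow>
     range W = {A. ce A} \<and>
     uniformly_ce_seq W \<and>
     (\<forall>V. uniformly_ce_seq V \<longrightarrow> (\<exists>g. computable g \<and> (\<forall>e. V e = W (g e))))"

definition uniformly_ce_family :: "(nat \<Rightarrow> nat set) \<Rightarrow> nat set set \<Rightarrow> bool" where
  "uniformly_ce_family W L \<longleftrightarrow> (\<exists>g. computable g \<and> L = {W (g k) | k. True})"


section \<open>Learning from text\<close>

text \<open>Computability on strings is understood via the effective bijection \<^const>\<open>list_encode\<close>.\<close>

definition learner :: "(nat list \<Rightarrow> nat) \<Rightarrow> bool" where
  "learner M \<longleftrightarrow> (\<exists>f. computable f \<and> (\<forall>s. M s = f (list_encode s)))"

definition content :: "(nat \<Rightarrow> nat) \<Rightarrow> nat set" where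
  "content f = range f"

definition init_seg :: "(nat \<Rightarrow> nat) \<Rightarrow> nat \<Rightarrow> nat list" where
  "init_seg f n = map f [0..<n]"

text \<open>The bounds \<open>i\<close> and \<open>j\<close> range over \<^typ>\<open>enat\<close>, where \<open>\<infinity>\<close> plays the role of \<open>*\<close>.\<close>

definition variant_eq :: "enat \<Rightarrow> nat set \<Rightarrow> nat set \<Rightarrow> bool" where
  "variant_eq i A B \<longleftrightarrow>
     finite ((A - B) \<union> (B - A)) \<and> enat (card ((A - B) \<union> (B - A))) \<le> i"

definition TxtFex_identifies ::
  "(nat \<Rightarrow> nat set) \<Rightarrow> enat \<Rightarrow> enat \<Rightarrow> (nat list \<Rightarrow> nat) \<Rightarrow> (nat \<Rightarrow> nat) \<Rightarrow> bool" where
  "TxtFex_identifies W i j M f \<longleftrightarrow>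
     (\<exists>S. finite S \<and> enat (card S) \<le> j \<and>
          (\<forall>\<^sub>\<infinity>n. M (init_seg f n) \<in> S) \<and>
          (\<forall>a\<in>S. variant_eq i (W a) (content f)))"

definition TxtFext_identifies ::
  "(nat \<Rightarrow> nat set) \<Rightarrow> enat \<Rightarrow> enat \<Rightarrow> (nat list \<Rightarrow> nat) \<Rightarrow> (nat \<Rightarrow> nat) \<Rightarrow> bool" where
  "TxtFext_identifies W i j M f \<longleftrightarrow>
     (\<exists>S. finite S \<and> enat (card S) \<le> j \<and>
          (\<forall>\<^sub>\<infinity>n. M (init_seg f n) \<in> S) \<and>
          (\<forall>a\<in>S. \<forall>b\<in>S. W a = W b \<and> variant_eq i (W b) (content f)))"

definition TxtFex :: "(nat \<Rightarrow> nat set) \<Rightarrow> enat \<Rightarrow> enat \<Rightarrow> nat set set set" where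
  "TxtFex W i j =
     {L. (\<forall>A\<in>L. ce A) \<and>
         (\<exists>M. learner M \<and> (\<forall>A\<in>L. \<forall>f. content f = A \<longrightarrow> TxtFex_identifies W i j M f))}"

definition TxtFext :: "(nat \<Rightarrow> nat set) \<Rightarrow> enat \<Rightarrow> enat \<Rightarrow> nat set set set" where
  "TxtFext W i j =
     {L. (\<forall>A\<in>L. ce A) \<and>
         (\<exists>M. learner M \<and> (\<forall>A\<in>L. \<forall>f. content f = A \<longrightarrow> TxtFext_identifies W i j M f))}"

end

theory Submission
  imports Defs "HOL-Library.Sublist" "HOL-Library.Countable_Set"
begin

text \<open>
  For every index \<open>e\<close> a construction inside the column \<open>{\<langle>e, y\<rangle> | y}\<close> defeats the learner \<open>M\<close> whose
  graph is \<open>W\<^sub>e\<close>. It enumerates one set \<open>Q\<close>, and every member of the family is a finite variant of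
  \<open>Q\<close> or of the whole column; the vacillating learner only ever outputs an index \<open>q\<close> of \<open>Q\<close> and
  an index \<open>p\<close> of the column.

  The construction searches for a witness \<open>x\<close> and for pairwise distinct hypotheses of \<open>M\<close> all of
  which contain \<open>x\<close>, while \<open>x\<close> is withheld from \<open>Q\<close>. Given a list \<open>K\<close> of \<open>j\<close> hypotheses containing
  \<open>x\<close>, a fresh number \<open>z\<close> is added to the text; as long as \<open>z\<close> is active the target is
  \<open>Q \<union> {z}\<close>. If infinitely many witnesses were found in vain, then on \<open>Q \<union> {z}\<close> one of
  the finitely many hypotheses of \<open>M\<close> would contain infinitely many numbers outside of the target.
  Hence \<open>M\<close> eventually outputs some \<open>b\<close> not containing \<open>x\<close>. The text is then continued in such a
  way that \<open>M\<close> outputs all of \<open>K\<close> and \<open>b\<close> infinitely often, and \<open>x\<close> is still withheld. Now \<open>Q\<close> is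
  cofinite, so \<open>p\<close> and \<open>q\<close> are both correct up to finitely many errors, whereas \<open>M\<close> has to
  enumerate \<open>x\<close> into \<open>W\<^sub>b\<close>, because all its final hypotheses must denote the same set. This produces
  a list of \<open>j + 1\<close> hypotheses containing a common \<open>x\<close>. While \<open>M\<close> only uses hypotheses below
  \<open>k\<close> this cannot go on for \<open>k + 1\<close> rounds, and whenever \<open>M\<close> uses a larger hypothesis everything withheld
  is released and \<open>k\<close> is increased; if that happens infinitely often, \<open>M\<close> outputs infinitely many
  hypotheses on a text of the column.
\<close>

section \<open>Computable functions on numbers\<close>

lemma rec_eval_Comp1:
  "rec_eval g xs y \<Longrightarrow> rec_eval f [y] z \<Longrightarrow> rec_eval (Comp f [g]) xs z"
  by (rule rec_eval.Comp[of _ _ "[y]"]) auto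

lemma rec_eval_Comp2:
  "rec_eval g xs y \<Longrightarrow> rec_eval g' xs y' \<Longrightarrow> rec_eval f [y, y'] z
    \<Longrightarrow> rec_eval (Comp f [g, g']) xs z"
  by (rule rec_eval.Comp[of _ _ "[y, y']"]) auto

lemma rec_eval_Proj: "i < length xs \<Longrightarrow> y = xs ! i \<Longrightarrow> rec_eval (Proj i) xs y"
  using rec_eval.Proj by simp

lemma rec_eval_PrimRec:
  assumes "rec_eval f xs b" and "\<And>i r. rec_eval g (i # r # xs) (s i r)"
  shows "rec_eval (PrimRec f g) (n # xs) (rec_nat b s n)"
  by (induction n) (use assms in \<open>auto intro: rec_eval.PrimRec_0 rec_eval.PrimRec_Suc\<close>)

definition computable2 :: "(nat \<Rightarrow> nat \<Rightarrow> nat) \<Rightarrow> bool" where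
  "computable2 f \<longleftrightarrow> (\<exists>p. \<forall>x y. rec_eval p [x, y] (f x y))"

lemma computable_id: "computable (\<lambda>x. x)"
  unfolding computable_def by (rule exI[of _ "Proj 0"]) (auto intro: rec_eval_Proj)

lemma computable_Suc: "computable Suc"
  unfolding computable_def by (rule exI[of _ Succ]) (auto intro: rec_eval.Succ)

lemma computable_compose:
  assumes "computable f" "computable g"
  shows "computable (\<lambda>x. f (g x))"
proof -
  from assms obtain p q where "\<And>x. rec_eval p [x] (f x)" "\<And>x. rec_eval q [x] (g x)"
    unfolding computable_def by blast
  then have "\<forall>x. rec_eval (Comp p [q]) [x] (f (g x))"
    by (blast intro: rec_eval_Comp1)
  then show ?thesis unfolding computable_def by blast
qed

lemma computable_const: "computable (\<lambda>x. c)"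
proof (induction c)
  case 0
  show ?case unfolding computable_def by (rule exI[of _ Zero]) (auto intro: rec_eval.Zero)
next
  case (Suc c)
  show ?case using computable_compose[OF computable_Suc Suc] .
qed

lemma computable2_compose:
  assumes "computable2 f" "computable g" "computable g'"
  shows "computable (\<lambda>x. f (g x) (g' x))"
proof -
  from assms obtain p q q' where "\<And>x y. rec_eval p [x, y] (f x y)" "\<And>x. rec_eval q [x] (g x)"
     "\<And>x. rec_eval q' [x] (g' x)"
    unfolding computable_def computable2_def by blast
  then have "\<forall>x. rec_eval (Comp p [q, q']) [x] (f (g x) (g' x))"
    by (blast intro: rec_eval_Comp2)
  then show ?thesis unfolding computable_def by blast
qed

lemma computable2_compose_outer:
  assumes "computable f" "computable2 g"
  shows "computable2 (\<lambda>x y. f (g x y))"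
proof -
  from assms obtain p q where "\<And>x. rec_eval p [x] (f x)" "\<And>x y. rec_eval q [x, y] (g x y)"
    unfolding computable_def computable2_def by blast
  then have "\<forall>x y. rec_eval (Comp p [q]) [x, y] (f (g x y))"
    by (blast intro: rec_eval_Comp1)
  then show ?thesis unfolding computable2_def by blast
qed

lemma computable2_compose2:
  assumes "computable2 f" "computable2 g" "computable2 g'"
  shows "computable2 (\<lambda>x y. f (g x y) (g' x y))"
proof -
  from assms obtain p q q' where "\<And>x y. rec_eval p [x, y] (f x y)"
     "\<And>x y. rec_eval q [x, y] (g x y)" "\<And>x y. rec_eval q' [x, y] (g' x y)"
    unfolding computable2_def by blast
  then have "\<forall>x y. rec_eval (Comp p [q, q']) [x, y] (f (g x y) (g' x y))"
    by (blast intro: rec_eval_Comp2)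
  then show ?thesis unfolding computable2_def by blast
qed

lemma computable2_fst: "computable2 (\<lambda>x y. x)"
  unfolding computable2_def by (rule exI[of _ "Proj 0"]) (auto intro: rec_eval_Proj)

lemma computable2_snd: "computable2 (\<lambda>x y. y)"
  unfolding computable2_def by (rule exI[of _ "Proj 1"]) (auto intro: rec_eval_Proj)

lemma computable_rec0:
  assumes "computable2 s"
  shows "computable (rec_nat c s)"
proof -
  obtain p where p: "\<And>x y. rec_eval p [x, y] (s x y)"
    using assms unfolding computable2_def by blast
  obtain q where q: "\<And>x. rec_eval q [x] c"
    using computable_const unfolding computable_def by blast
  \<comment> \<open>\<open>Zero\<close> is defined on every argument list, so feeding it to
    \<open>q\<close> yields the constant \<open>c\<close> even on the empty list that the base case
    receives here.\<close>
  have "rec_eval (Comp q [Zero]) [] c"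
    by (rule rec_eval_Comp1[OF rec_eval.Zero q])
  then have "\<forall>n. rec_eval (PrimRec (Comp q [Zero]) p) [n] (rec_nat c s n)"
    using p by (blast intro: rec_eval_PrimRec)
  then show ?thesis unfolding computable_def by blast
qed

lemma computable2_add: "computable2 (+)"
proof -
  have "\<forall>x y. rec_eval (PrimRec (Proj 0) (Comp Succ [Proj 1])) [x, y] (rec_nat y (\<lambda>_. Suc) x)"
    by (intro allI rec_eval_PrimRec rec_eval_Comp1 rec_eval_Proj) (auto intro: rec_eval.Succ)
  moreover have "rec_nat y (\<lambda>_. Suc) x = x + y" for x y
    by (induction x) auto
  ultimately show ?thesis unfolding computable2_def by auto
qed

lemma computable_pred: "computable (\<lambda>x. x - 1)"
proof -
  have "(\<lambda>x. x - 1) = rec_nat 0 (\<lambda>i _. i)"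
  proof
    fix x :: nat show "x - 1 = rec_nat 0 (\<lambda>i _. i) x" by (cases x) auto
  qed
  then show ?thesis using computable_rec0[OF computable2_fst] by simp
qed

lemma computable2_diff: "computable2 (-)"
proof -
  obtain p where p: "\<And>x. rec_eval p [x] (x - 1)"
    using computable_pred unfolding computable_def by blast
  \<comment> \<open>Recursion runs on the first argument, so the subtrahend comes first; the
    arguments are swapped back at the end.\<close>
  have "\<forall>y x. rec_eval (PrimRec (Proj 0) (Comp p [Proj 1])) [y, x] (rec_nat x (\<lambda>_ r. r - 1) y)"
    by (intro allI rec_eval_PrimRec rec_eval_Comp1[OF _ p] rec_eval_Proj) auto
  moreover have "rec_nat x (\<lambda>_ r. r - 1) y = x - y" for x y :: nat
    by (induction y) auto
  ultimately have "computable2 (\<lambda>y x. x - y)" unfolding computable2_def by auto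
  from computable2_compose2[OF this computable2_snd computable2_fst] show ?thesis .
qed

lemma computable_triangle: "computable triangle"
proof -
  have "triangle n = rec_nat 0 (\<lambda>i r. r + Suc i) n" for n
    by (induction n) auto
  then have *: "triangle = rec_nat 0 (\<lambda>i r. r + Suc i)" by blast
  show ?thesis unfolding *
    by (intro computable_rec0 computable2_compose2[OF computable2_add]
        computable2_compose_outer[OF computable_Suc] computable2_fst computable2_snd)
qed

lemma computable2_prod_encode: "computable2 (\<lambda>x y. prod_encode (x, y))"
  unfolding prod_encode_def split
  by (intro computable2_compose2[OF computable2_add] computable2_compose_outer[OF computable_triangle]
        computable2_fst computable2_snd)

text \<open>The diagonal \<open>x + y\<close> on which a code \<open>n\<close> lies is found by unbounded search.\<close>

lemma prod_decode_triangle: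
  assumes "prod_decode n = (x, y)"
  shows "x = n - triangle (x + y)" "(LEAST k. n < triangle (Suc k)) = x + y"
proof -
  have n: "n = triangle (x + y) + x"
    using prod_decode_inverse[of n] assms by (simp add: prod_encode_def)
  then show "x = n - triangle (x + y)" by simp
  have mono: "triangle i \<le> triangle j" if "i \<le> j" for i j
    using that by (induction rule: dec_induct) auto
  show "(LEAST k. n < triangle (Suc k)) = x + y"
  proof (rule Least_equality)
    show "n < triangle (Suc (x + y))" using n by simp
    fix k assume k: "n < triangle (Suc k)"
    show "x + y \<le> k"
    proof (rule ccontr)
      assume "\<not> x + y \<le> k"
      then show False using mono[of "Suc k" "x + y"] k n by linarith
    qed
  qed
qed

lemma computable_diagonal: "computable (\<lambda>n. LEAST k. n < triangle (Suc k))"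
proof -
  \<comment> \<open>Truncated subtraction turns the test \<open>n < triangle (Suc k)\<close> into a
    value being 0, which is what \<open>Mu\<close> searches for.\<close>
  have "computable2 (\<lambda>k n. Suc n - triangle (Suc k))"
    by (intro computable2_compose2[OF computable2_diff] computable2_compose_outer[OF computable_triangle]
        computable2_compose_outer[OF computable_Suc] computable2_fst computable2_snd)
  then obtain p where p: "\<And>k n. rec_eval p [k, n] (Suc n - triangle (Suc k))"
    unfolding computable2_def by blast
  have "rec_eval (Mu p) [n] (LEAST k. n < triangle (Suc k))" for n
  proof (rule rec_eval.Mu)
    have "n < triangle (Suc n)" by (induction n) auto
    then have "n < triangle (Suc (LEAST k. n < triangle (Suc k)))"
      by (rule LeastI)
    then have "Suc n - triangle (Suc (LEAST k. n < triangle (Suc k))) = 0" by simp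
    then show "rec_eval p [LEAST k. n < triangle (Suc k), n] 0" using p by metis
    fix k assume "k < (LEAST k. n < triangle (Suc k))"
    then have "\<not> n < triangle (Suc k)" by (rule not_less_Least)
    then have "Suc n - triangle (Suc k) = Suc (n - triangle (Suc k))" by linarith
    then show "\<exists>r. rec_eval p [k, n] (Suc r)" using p by metis
  qed
  then show ?thesis unfolding computable_def by blast
qed

lemma computable_fst_decode: "computable (\<lambda>n. fst (prod_decode n))"
proof -
  have "fst (prod_decode n) = n - triangle (LEAST k. n < triangle (Suc k))" for n
    using prod_decode_triangle[of n "fst (prod_decode n)" "snd (prod_decode n)"] by simp
  then show ?thesis
    by (simp only:) (intro computable2_compose[OF computable2_diff] computable_id
        computable_compose[OF computable_triangle] computable_diagonal)
qed

lemma computable_snd_decode: "computable (\<lambda>n. snd (prod_decode n))"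
proof -
  have "snd (prod_decode n) = (LEAST k. n < triangle (Suc k)) - fst (prod_decode n)" for n
    using prod_decode_triangle[of n "fst (prod_decode n)" "snd (prod_decode n)"] by simp
  then show ?thesis
    by (simp only:) (intro computable2_compose[OF computable2_diff] computable_diagonal
        computable_fst_decode)
qed

text \<open>The iteration count and the parameter are packed into one number, and likewise the three
  arguments of the step function. In this unary form the recursion scheme transfers to coded
  types.\<close>

lemma computable_rec:
  assumes b: "computable b" and s: "computable s"
  shows "computable (\<lambda>c. rec_nat (b (snd (prod_decode c)))
     (\<lambda>i r. s (prod_encode (i, prod_encode (r, snd (prod_decode c))))) (fst (prod_decode c)))"
proof -
  obtain p where p: "\<And>x. rec_eval p [x] (b x)" using b unfolding computable_def by blast
  obtain q where q: "\<And>x. rec_eval q [x] (s x)" using s unfolding computable_def by blast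
  obtain c where c: "\<And>x y. rec_eval c [x, y] (prod_encode (x, y))"
    using computable2_prod_encode unfolding computable2_def by blast
  let ?q = "Comp q [Comp c [Proj 0, Comp c [Proj 1, Proj 2]]]"
  have "\<forall>n x. rec_eval (PrimRec p ?q) [n, x]
      (rec_nat (b x) (\<lambda>i r. s (prod_encode (i, prod_encode (r, x)))) n)"
    by (intro allI rec_eval_PrimRec rec_eval_Comp1[OF _ q] rec_eval_Comp2[OF _ _ c] p
        rec_eval_Proj) auto
  then have "computable2 (\<lambda>n x. rec_nat (b x) (\<lambda>i r. s (prod_encode (i, prod_encode (r, x)))) n)"
    unfolding computable2_def by blast
  from computable2_compose[OF this computable_fst_decode computable_snd_decode] show ?thesis .
qed


section \<open>Computable functions between coded types\<close>

text \<open>Only injectivity is asked, since \<open>bool\<close>, say, uses just the codes 0 and 1.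
  Surjectivity is assumed separately where numbers must be decoded.\<close>

class coded =
  fixes code :: "'a \<Rightarrow> nat"
  assumes inj_code: "inj code"

lemma code_eq_iff [simp]: "code x = code y \<longleftrightarrow> x = y"
  using inj_code by (rule inj_eq)

instantiation nat :: coded
begin
definition code_nat :: "nat \<Rightarrow> nat" where [simp]: "code_nat n = n"
instance by standard (simp add: inj_def)
end

instantiation bool :: coded
begin
definition code_bool :: "bool \<Rightarrow> nat" where [simp]: "code_bool b = (if b then 1 else 0)"
instance by standard (simp add: inj_def)
end

instantiation prod :: (coded, coded) coded
begin
definition code_prod :: "'a \<times> 'b \<Rightarrow> nat" where
  [simp]: "code_prod p = prod_encode (code (fst p), code (snd p))"
instance by standard (auto simp: inj_def prod_encode_eq)
end

instantiation list :: (coded) coded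
begin
definition code_list :: "'a list \<Rightarrow> nat" where "code_list xs = list_encode (map code xs)"
instance by standard (auto simp: inj_def code_list_def list_encode_eq inj_map_eq_map[OF inj_code])
end

lemma code_Nil [simp]: "code [] = 0"
  by (simp add: code_list_def)

lemma code_Cons [simp]: "code (x # xs) = Suc (prod_encode (code x, code xs))"
  by (simp add: code_list_def)

lemma surj_code_nat: "surj (code :: nat \<Rightarrow> nat)"
  by (simp add: surj_def)

lemma surj_code_prod:
  assumes "surj (code :: 'a::coded \<Rightarrow> nat)" "surj (code :: 'b::coded \<Rightarrow> nat)"
  shows "surj (code :: 'a \<times> 'b \<Rightarrow> nat)"
proof (rule surjI)
  fix n
  show "code (inv code (fst (prod_decode n)) :: 'a, inv code (snd (prod_decode n)) :: 'b) = n"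
    using assms by (simp add: surj_f_inv_f)
qed

lemma surj_code_list:
  assumes "surj (code :: 'a::coded \<Rightarrow> nat)"
  shows "surj (code :: 'a list \<Rightarrow> nat)"
proof (rule surjI)
  fix n
  have "map (code \<circ> (inv code :: nat \<Rightarrow> 'a)) (list_decode n) = list_decode n"
    using assms by (simp add: surj_f_inv_f map_idI)
  then show "code (map (inv code :: nat \<Rightarrow> 'a) (list_decode n)) = n"
    by (simp add: code_list_def)
qed

text \<open>Computability by tracking: \<open>g\<close> works on codes and may do anything on
  numbers that code nothing. The rules \<open>cmp_intros\<close> follow the syntax of an expression,
  so that composite definitions are shown computable by introduction.\<close>

definition cmp :: "('a::coded \<Rightarrow> 'b::coded) \<Rightarrow> bool" where
  "cmp f \<longleftrightarrow> (\<exists>g. computable g \<and> (\<forall>x. g (code x) = code (f x)))"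

named_theorems cmp_intros

lemma cmp_nat_iff: "cmp (f :: nat \<Rightarrow> nat) \<longleftrightarrow> computable f"
proof
  assume "cmp f"
  then obtain g where "computable g" "\<And>x. g x = f x" unfolding cmp_def by auto
  then show "computable f" using ext[of g f] by simp
next
  assume "computable f"
  then show "cmp f" unfolding cmp_def by (intro exI[of _ f]) simp
qed

lemma cmp_compose:
  assumes "cmp f" "cmp g" shows "cmp (\<lambda>x. f (g x))"
proof -
  from assms obtain f' g' where "computable f'" "computable g'" "\<And>x. f' (code x) = code (f x)"
    "\<And>x. g' (code x) = code (g x)" unfolding cmp_def by blast
  then show ?thesis unfolding cmp_def
    by (intro exI[of _ "\<lambda>x. f' (g' x)"]) (auto intro: computable_compose)
qed

lemma cmp_id [cmp_intros]: "cmp (\<lambda>x. x)"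
  unfolding cmp_def using computable_id by blast

lemma cmp_const [cmp_intros]: "cmp (\<lambda>x. c)"
  unfolding cmp_def using computable_const by blast

lemma cmp_Pair [cmp_intros]:
  assumes "cmp f" "cmp g" shows "cmp (\<lambda>x. (f x, g x))"
proof -
  from assms obtain f' g' where "computable f'" "computable g'" "\<And>x. f' (code x) = code (f x)"
    "\<And>x. g' (code x) = code (g x)" unfolding cmp_def by blast
  then show ?thesis unfolding cmp_def
    by (intro exI[of _ "\<lambda>x. prod_encode (f' x, g' x)"])
      (auto intro: computable2_compose[OF computable2_prod_encode])
qed

lemma cmp_fst [cmp_intros]:
  assumes "cmp f" shows "cmp (\<lambda>x. fst (f x))"
proof -
  have "cmp (fst :: 'b \<times> 'c \<Rightarrow> 'b)" unfolding cmp_def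
    by (intro exI[of _ "\<lambda>n. fst (prod_decode n)"]) (auto intro: computable_fst_decode)
  from cmp_compose[OF this assms] show ?thesis .
qed

lemma cmp_snd [cmp_intros]:
  assumes "cmp f" shows "cmp (\<lambda>x. snd (f x))"
proof -
  have "cmp (snd :: 'b \<times> 'c \<Rightarrow> 'c)" unfolding cmp_def
    by (intro exI[of _ "\<lambda>n. snd (prod_decode n)"]) (auto intro: computable_snd_decode)
  from cmp_compose[OF this assms] show ?thesis .
qed

lemma cmp_code [cmp_intros]:
  assumes "cmp f" shows "cmp (\<lambda>x. code (f x))"
  using assms unfolding cmp_def by simp

text \<open>The recursion \<open>F\<close> on codes stays synchronised with \<open>rec_nat\<close>
  at every iteration, the parameter being carried along as its code.\<close>

lemma cmp_rec_nat [cmp_intros]: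
  fixes s :: "'a::coded \<Rightarrow> nat \<Rightarrow> 'b::coded \<Rightarrow> 'b"
  assumes b: "cmp b" and s: "cmp (\<lambda>p. s (snd (snd p)) (fst p) (fst (snd p)))" and n: "cmp n"
  shows "cmp (\<lambda>x. rec_nat (b x) (s x) (n x))"
proof -
  from b obtain b' where b': "computable b'" "\<And>x. b' (code x) = code (b x)"
    unfolding cmp_def by blast
  from s obtain s' where s': "computable s'"
    "\<And>p :: nat \<times> 'b \<times> 'a. s' (code p) = code (s (snd (snd p)) (fst p) (fst (snd p)))"
    unfolding cmp_def by blast
  from n obtain n' where n': "computable n'" "\<And>x. n' (code x) = n x"
    unfolding cmp_def by auto
  have s'': "s' (prod_encode (i, prod_encode (code r, code x))) = code (s x i r)" for i r x
    using s'(2)[of "(i, r, x)"] by simp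
  define F where "F c = rec_nat (b' (snd (prod_decode c)))
     (\<lambda>i r. s' (prod_encode (i, prod_encode (r, snd (prod_decode c))))) (fst (prod_decode c))" for c
  have "computable F" unfolding F_def by (rule computable_rec[OF b'(1) s'(1)])
  then have "computable (\<lambda>x. F (prod_encode (n' x, x)))"
    by (rule computable_compose)
      (intro computable2_compose[OF computable2_prod_encode] n' computable_id)
  moreover have "rec_nat (b' (code x)) (\<lambda>i r. s' (prod_encode (i, prod_encode (r, code x)))) k
      = code (rec_nat (b x) (s x) k)" for x k
    by (induction k) (auto simp: b' s'')
  then have "F (prod_encode (n' (code x), code x)) = code (rec_nat (b x) (s x) (n x))" for x
    unfolding F_def by (simp add: n')
  ultimately show ?thesis unfolding cmp_def by blast
qed

lemma cmp_Suc [cmp_intros]: "cmp f \<Longrightarrow> cmp (\<lambda>x. Suc (f x))"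
  using cmp_compose[of Suc f] by (simp add: cmp_nat_iff computable_Suc)

lemma cmp_computable: "computable h \<Longrightarrow> cmp f \<Longrightarrow> cmp (\<lambda>x. h (f x))"
  by (rule cmp_compose) (simp add: cmp_nat_iff)

lemma cmp_binary:
  assumes "computable2 h" "cmp f" "cmp g" shows "cmp (\<lambda>x. h (f x) (g x))"
proof -
  from assms obtain f' g' where "computable f'" "computable g'" "\<And>x. f' (code x) = f x"
    "\<And>x. g' (code x) = g x" unfolding cmp_def by auto
  then show ?thesis unfolding cmp_def
    by (intro exI[of _ "\<lambda>x. h (f' x) (g' x)"]) (auto intro: computable2_compose assms)
qed

lemma cmp_add [cmp_intros]: "cmp f \<Longrightarrow> cmp g \<Longrightarrow> cmp (\<lambda>x. f x + g x :: nat)"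
  by (rule cmp_binary[OF computable2_add])

lemma cmp_diff [cmp_intros]: "cmp f \<Longrightarrow> cmp g \<Longrightarrow> cmp (\<lambda>x. f x - g x :: nat)"
  by (rule cmp_binary[OF computable2_diff])

lemma cmp_mult2 [cmp_intros]: "cmp f \<Longrightarrow> cmp (\<lambda>x. 2 * f x :: nat)"
  unfolding mult_2 by (intro cmp_intros)

lemma cmp_prod_encode [cmp_intros]: "cmp f \<Longrightarrow> cmp (\<lambda>x. prod_encode (f x))"
proof -
  have "cmp prod_encode" unfolding cmp_def
    by (rule exI[of _ "\<lambda>x. x"]) (simp add: computable_id)
  then show "cmp f \<Longrightarrow> cmp (\<lambda>x. prod_encode (f x))" by (rule cmp_compose)
qed

lemma cmp_prod_decode [cmp_intros]: "cmp f \<Longrightarrow> cmp (\<lambda>x. prod_decode (f x))"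
proof -
  have "cmp prod_decode" unfolding cmp_def
    by (rule exI[of _ "\<lambda>x. x"]) (simp add: computable_id)
  then show "cmp f \<Longrightarrow> cmp (\<lambda>x. prod_decode (f x))" by (rule cmp_compose)
qed

text \<open>For a surjective \<open>code\<close>, decoding and then coding gives back the number, so
  the decoder is tracked by the identity.\<close>

lemma cmp_inv_code:
  assumes "surj (code :: 'a::coded \<Rightarrow> nat)" "cmp f"
  shows "cmp (\<lambda>x. inv (code :: 'a \<Rightarrow> nat) (f x))"
proof -
  have "cmp (inv (code :: 'a \<Rightarrow> nat))"
    unfolding cmp_def
    by (rule exI[of _ "\<lambda>x. x"]) (simp add: computable_id surj_f_inv_f[OF assms(1)])
  from cmp_compose[OF this assms(2)] show ?thesis .
qed

section \<open>Decidable predicates and case distinctions\<close>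

lemma cmp_eq0:
  assumes "cmp f" shows "cmp (\<lambda>x. f x = (0::nat))"
proof -
  have "cmp (\<lambda>x. rec_nat True (\<lambda>_ _. False) (f x))" by (intro cmp_intros assms)
  moreover have "rec_nat True (\<lambda>_ _. False) n \<longleftrightarrow> n = 0" for n by (cases n) auto
  ultimately show ?thesis by simp
qed

lemma cmp_if [cmp_intros]:
  assumes P: "cmp P" and f: "cmp f" and g: "cmp g"
  shows "cmp (\<lambda>x. if P x then f x else g x)"
proof -
  \<comment> \<open>\<open>code (P x)\<close> is 1 or 0, so a recursion of that length either yields
    \<open>f x\<close> or stops at its base value \<open>g x\<close>.\<close>
  have "cmp (\<lambda>x. rec_nat (g x) (\<lambda>_ _. f x) (code (P x)))" by (intro cmp_intros assms cmp_compose[OF f])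
  moreover have "rec_nat (g x) (\<lambda>_ _. f x) (code (P x)) = (if P x then f x else g x)" for x by simp
  ultimately show ?thesis by (simp only:)
qed

lemma cmp_not [cmp_intros]:
  assumes "cmp P" shows "cmp (\<lambda>x. \<not> P x)"
proof -
  have "cmp (\<lambda>x. if P x then False else True)" by (intro cmp_if cmp_const assms)
  moreover have "(\<lambda>x. if P x then False else True) = (\<lambda>x. \<not> P x)" by auto
  ultimately show ?thesis by metis
qed

lemma cmp_conj [cmp_intros]:
  assumes "cmp P" "cmp Q" shows "cmp (\<lambda>x. P x \<and> Q x)"
proof -
  have "cmp (\<lambda>x. if P x then Q x else False)" by (intro cmp_if cmp_const assms)
  moreover have "(\<lambda>x. if P x then Q x else False) = (\<lambda>x. P x \<and> Q x)" by auto
  ultimately show ?thesis by metis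
qed

lemma cmp_disj [cmp_intros]:
  assumes "cmp P" "cmp Q" shows "cmp (\<lambda>x. P x \<or> Q x)"
proof -
  have "cmp (\<lambda>x. if P x then True else Q x)" by (intro cmp_if cmp_const assms)
  moreover have "(\<lambda>x. if P x then True else Q x) = (\<lambda>x. P x \<or> Q x)" by auto
  ultimately show ?thesis by metis
qed

lemma cmp_le [cmp_intros]:
  assumes "cmp f" "cmp g" shows "cmp (\<lambda>x. f x \<le> (g x :: nat))"
proof -
  have "cmp (\<lambda>x. f x - g x = 0)" by (intro cmp_eq0 cmp_intros assms)
  then show ?thesis by simp
qed

lemma cmp_less [cmp_intros]: "cmp f \<Longrightarrow> cmp g \<Longrightarrow> cmp (\<lambda>x. f x < (g x :: nat))"
  unfolding less_eq_Suc_le by (intro cmp_intros)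

lemma cmp_eq [cmp_intros]:
  assumes "cmp f" "cmp g" shows "cmp (\<lambda>x. f x = g x)"
proof -
  have "cmp (\<lambda>x. code (f x) \<le> code (g x) \<and> code (g x) \<le> code (f x))" by (intro cmp_intros assms)
  moreover have "code u \<le> code v \<and> code v \<le> code u \<longleftrightarrow> u = v" for u v :: 'b
    using code_eq_iff[of u v] by auto
  ultimately show ?thesis by simp
qed

lemma cmp_odd [cmp_intros]:
  assumes "cmp f" shows "cmp (\<lambda>x. odd (f x :: nat))"
proof -
  have "cmp (\<lambda>x. rec_nat False (\<lambda>_ b. \<not> b) (f x))" by (intro cmp_intros assms)
  moreover have "rec_nat False (\<lambda>_ b. \<not> b) n = odd n" for n :: nat by (induction n) auto
  ultimately show ?thesis by simp
qed

lemma cmp_even [cmp_intros]: "cmp f \<Longrightarrow> cmp (\<lambda>x. even (f x :: nat))"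
  using cmp_not[OF cmp_odd, of f] by simp

lemma cmp_half [cmp_intros]:
  assumes "cmp f" shows "cmp (\<lambda>x. f x div (2::nat))"
proof -
  have "cmp (\<lambda>x. rec_nat 0 (\<lambda>i r. if odd i then Suc r else r) (f x))" by (intro cmp_intros assms)
  moreover have "rec_nat 0 (\<lambda>i r. if odd i then Suc r else r) n = n div 2" for n :: nat
    by (induction n) auto
  ultimately show ?thesis by simp
qed

lemma cmp_ex_less [cmp_intros]:
  fixes P :: "'a::coded \<Rightarrow> nat \<Rightarrow> bool"
  assumes P: "cmp (\<lambda>p. P (snd p) (fst p))" and n: "cmp n"
  shows "cmp (\<lambda>x. \<exists>i < n x. P x i)"
proof -
  have "cmp (\<lambda>x. rec_nat False (\<lambda>i b. b \<or> P x i) (n x))"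
    by (intro cmp_intros n cmp_compose[OF P, of "\<lambda>p. (fst p, snd (snd p))", simplified])
  moreover have "rec_nat False (\<lambda>i b. b \<or> P x i) k \<longleftrightarrow> (\<exists>i < k. P x i)" for x k
    by (induction k) (auto simp: less_Suc_eq)
  ultimately show ?thesis by simp
qed

lemma cmp_all_less [cmp_intros]:
  assumes P: "cmp (\<lambda>p. P (snd p) (fst p))" and n: "cmp n"
  shows "cmp (\<lambda>x. \<forall>i < (n x :: nat). P x i)"
  using cmp_not[OF cmp_ex_less[OF cmp_not[OF P] n]] by simp

section \<open>Lists\<close>

lemma cmp_Cons [cmp_intros]:
  assumes "cmp f" "cmp g" shows "cmp (\<lambda>x. f x # g x)"
proof -
  from assms obtain f' g' where "computable f'" "computable g'" "\<And>x. f' (code x) = code (f x)"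
    "\<And>x. g' (code x) = code (g x)" unfolding cmp_def by blast
  then show ?thesis unfolding cmp_def
    by (intro exI[of _ "\<lambda>x. Suc (prod_encode (f' x, g' x))"])
      (auto intro: computable2_compose[OF computable2_prod_encode] computable_compose[OF computable_Suc])
qed

lemma cmp_tl [cmp_intros]:
  assumes "cmp f" shows "cmp (\<lambda>x. tl (f x))"
proof -
  \<comment> \<open>The empty list has code 0, whose truncated predecessor is 0 again. Its tail
    comes out right because 0 decodes to a pair with second component 0.\<close>
  have "snd (prod_decode 0) = 0" by (simp add: prod_decode_def prod_decode_aux.simps)
  then have "snd (prod_decode (code xs - 1)) = code (tl xs)" for xs :: "'b list"
    by (cases xs) auto
  moreover have "computable (\<lambda>n. snd (prod_decode (n - 1)))"
    by (rule computable_compose[OF computable_snd_decode computable_pred])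
  ultimately have "cmp (tl :: 'b list \<Rightarrow> _)" unfolding cmp_def by blast
  from cmp_compose[OF this assms] show ?thesis .
qed

definition hd_or :: "'a \<Rightarrow> 'a list \<Rightarrow> 'a" where
  "hd_or d xs = (case xs of [] \<Rightarrow> d | y # _ \<Rightarrow> y)"

lemma cmp_hd_or [cmp_intros]:
  assumes "cmp f" shows "cmp (\<lambda>x. hd_or d (f x))"
proof -
  have "cmp (\<lambda>n::nat. if n = 0 then code d else fst (prod_decode (n - 1)))"
    by (intro cmp_intros)
  then have "computable (\<lambda>n::nat. if n = 0 then code d else fst (prod_decode (n - 1)))"
    by (simp only: cmp_nat_iff)
  moreover have "(if code xs = 0 then code d else fst (prod_decode (code xs - 1))) = code (hd_or d xs)"
    for xs :: "'b list"
    by (cases xs) (auto simp: hd_or_def)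
  ultimately have "cmp (hd_or d)" unfolding cmp_def by blast
  from cmp_compose[OF this assms] show ?thesis .
qed

lemma length_le_code: "length xs \<le> code xs"
proof (induction xs)
  case (Cons x xs)
  then show ?case using le_prod_encode_2[of "code xs" "code x"] by simp
qed simp

text \<open>The fold is simulated by iterating \<open>G\<close> on pairs of accumulator and
  remaining list. The code of the list bounds its length, and surplus iterations do no harm because
  \<open>G\<close> fixes pairs with an empty list.\<close>

lemma cmp_foldl [cmp_intros]:
  fixes s :: "'a::coded \<Rightarrow> 'b::coded \<Rightarrow> 'c::coded \<Rightarrow> 'b"
  assumes s: "cmp (\<lambda>p. s (snd (snd p)) (fst p) (fst (snd p)))" and b: "cmp b" and l: "cmp l"
  shows "cmp (\<lambda>x. foldl (s x) (b x) (l x))"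
proof -
  obtain d :: 'c where True by blast
  define G where "G x p = (if snd p = [] then p else (s x (fst p) (hd_or d (snd p)), tl (snd p)))" for x p
  have "cmp (\<lambda>x. fst (rec_nat (b x, l x) (\<lambda>_. G x) (code (l x))))"
    unfolding G_def
    by (intro cmp_intros b l
      cmp_compose[OF s, of "\<lambda>p. (fst (fst (snd p)), hd_or d (snd (fst (snd p))), snd (snd p))", simplified])
  moreover have "fst (rec_nat (a, xs) (\<lambda>_. G x) n) = foldl (s x) a xs" if "length xs \<le> n" for x a xs n
  proof -
    have fix_Nil: "rec_nat (a, []) (\<lambda>_. G x) i = (a, [])" for a i
      by (induction i) (auto simp: G_def)
    have shift: "rec_nat p (\<lambda>_. G x) (Suc i) = rec_nat (G x p) (\<lambda>_. G x) i" for p i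
      by (induction i) auto
    show ?thesis using that
    proof (induction xs arbitrary: a n)
      case Nil
      then show ?case by (simp add: fix_Nil)
    next
      case (Cons y ys)
      then obtain i where n: "n = Suc i" by (cases n) auto
      have "G x (a, y # ys) = (s x a y, ys)" by (simp add: G_def hd_or_def)
      then show ?case using Cons.IH[of i "s x a y"] Cons.prems unfolding n shift by simp
    qed
  qed
  then have "fst (rec_nat (b x, l x) (\<lambda>_. G x) (code (l x))) = foldl (s x) (b x) (l x)" for x
    using length_le_code by blast
  ultimately show ?thesis by (simp only:)
qed

lemma cmp_rev [cmp_intros]:
  assumes "cmp f" shows "cmp (\<lambda>x. rev (f x))"
proof -
  have "cmp (\<lambda>x. foldl (\<lambda>a y. y # a) [] (f x))" by (intro cmp_intros assms)
  moreover have "foldl (\<lambda>a y. y # a) a xs = rev xs @ a" for a xs :: "'b list"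
    by (induction xs arbitrary: a) auto
  ultimately show ?thesis by simp
qed

lemma cmp_foldr [cmp_intros]:
  assumes "cmp (\<lambda>p. s (snd (snd p)) (fst (snd p)) (fst p))" and "cmp b" and "cmp l"
  shows "cmp (\<lambda>x. foldr (s x) (l x) (b x))"
  unfolding foldr_conv_foldl by (intro cmp_intros assms)

lemma cmp_append [cmp_intros]:
  assumes "cmp f" "cmp g" shows "cmp (\<lambda>x. f x @ g x)"
proof -
  have "cmp (\<lambda>x. foldr (\<lambda>y ys. y # ys) (f x) (g x))" by (intro cmp_intros assms)
  moreover have "foldr (\<lambda>y ys. y # ys) xs ys = xs @ ys" for xs ys :: "'b list" by (induction xs) auto
  ultimately show ?thesis by simp
qed

lemma cmp_map [cmp_intros]:
  fixes f :: "'a::coded \<Rightarrow> 'b::coded \<Rightarrow> 'c::coded"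
  assumes f: "cmp (\<lambda>p. f (snd p) (fst p))" and l: "cmp l"
  shows "cmp (\<lambda>x. map (f x) (l x))"
proof -
  have "cmp (\<lambda>x. foldr (\<lambda>y ys. f x y # ys) (l x) [])"
    by (intro cmp_intros l cmp_compose[OF f, of "\<lambda>p. (fst (snd p), snd (snd p))", simplified])
  moreover have "foldr (\<lambda>y ys. f x y # ys) xs [] = map (f x) xs" for x xs by (induction xs) auto
  ultimately show ?thesis by simp
qed

lemma cmp_filter [cmp_intros]:
  fixes P :: "'a::coded \<Rightarrow> 'b::coded \<Rightarrow> bool"
  assumes P: "cmp (\<lambda>p. P (snd p) (fst p))" and l: "cmp l"
  shows "cmp (\<lambda>x. filter (P x) (l x))"
proof -
  have "cmp (\<lambda>x. foldr (\<lambda>y ys. if P x y then y # ys else ys) (l x) [])"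
    by (intro cmp_intros l cmp_compose[OF P, of "\<lambda>p. (fst (snd p), snd (snd p))", simplified])
  moreover have "foldr (\<lambda>y ys. if P x y then y # ys else ys) xs [] = filter (P x) xs" for x xs
    by (induction xs) auto
  ultimately show ?thesis by simp
qed

lemma cmp_list_ex [cmp_intros]:
  assumes P: "cmp (\<lambda>p. P (snd p) (fst p))" and l: "cmp l"
  shows "cmp (\<lambda>x. \<exists>y\<in>set (l x). P x y)"
proof -
  have "cmp (\<lambda>x. \<not> filter (P x) (l x) = [])" by (intro cmp_intros P l)
  then show ?thesis by (simp add: filter_empty_conv)
qed

lemma cmp_list_all [cmp_intros]:
  assumes P: "cmp (\<lambda>p. P (snd p) (fst p))" and l: "cmp l"
  shows "cmp (\<lambda>x. \<forall>y\<in>set (l x). P x y)"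
  using cmp_not[OF cmp_list_ex[OF cmp_not[OF P] l]] by simp

lemma cmp_in_set [cmp_intros]:
  assumes "cmp f" "cmp l" shows "cmp (\<lambda>x. f x \<in> set (l x))"
proof -
  have "cmp (\<lambda>x. \<exists>y\<in>set (l x). y = f x)"
    by (intro cmp_intros assms cmp_compose[OF assms(1), of snd])
  then show ?thesis by simp
qed

lemma cmp_sum_list [cmp_intros]:
  assumes "cmp f" shows "cmp (\<lambda>x. sum_list (f x) :: nat)"
proof -
  have "cmp (\<lambda>x. foldr (\<lambda>y a. y + a) (f x) 0)" by (intro cmp_intros assms)
  moreover have "foldr (\<lambda>y a. y + a) xs 0 = sum_list xs" for xs :: "nat list" by (induction xs) auto
  ultimately show ?thesis by simp
qed

lemma cmp_length [cmp_intros]: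
  assumes "cmp f" shows "cmp (\<lambda>x. length (f x))"
proof -
  have "cmp (\<lambda>x. foldr (\<lambda>y a. Suc a) (f x) 0)" by (intro cmp_intros assms)
  moreover have "foldr (\<lambda>y a. Suc a) xs 0 = length xs" for xs :: "'b list" by (induction xs) auto
  ultimately show ?thesis by simp
qed

lemma cmp_upt [cmp_intros]:
  assumes "cmp f" shows "cmp (\<lambda>x. [0..<f x])"
proof -
  have "cmp (\<lambda>x. rec_nat [] (\<lambda>i l. l @ [i]) (f x))" by (intro cmp_intros assms)
  moreover have "rec_nat [] (\<lambda>i l. l @ [i]) n = [0..<n]" for n by (induction n) auto
  ultimately show ?thesis by simp
qed

text \<open>All pairs of a candidate and a time are run through. A pair failing the test outputs a
  fixed element \<open>a\<close> of the set, which keeps the enumeration total.\<close>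

lemma ce_Ex:
  assumes "cmp (\<lambda>p :: nat \<times> nat. P (fst p) (snd p))"
  shows "ce {x. \<exists>t. P x t}"
proof (cases "{x. \<exists>t. P x t} = {}")
  case False
  then obtain a where a: "\<exists>t. P a t" by blast
  define f where "f n = (if P (fst (prod_decode n)) (snd (prod_decode n)) then fst (prod_decode n) else a)" for n
  have "cmp f" unfolding f_def
    by (intro cmp_intros cmp_compose[OF assms, of prod_decode, simplified])
  then have "computable f" by (simp add: cmp_nat_iff)
  moreover have "{x. \<exists>t. P x t} = range f"
  proof
    show "{x. \<exists>t. P x t} \<subseteq> range f"
    proof
      fix x assume "x \<in> {x. \<exists>t. P x t}"
      then obtain t where "P x t" by blast
      then have "f (prod_encode (x, t)) = x" by (simp add: f_def)
      then show "x \<in> range f" by (metis rangeI)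
    qed
    show "range f \<subseteq> {x. \<exists>t. P x t}" using a by (auto simp: f_def)
  qed
  ultimately show ?thesis unfolding ce_def by blast
qed (simp add: ce_def)

section \<open>The construction\<close>

text \<open>
  An entry consists of a level, a list \<open>K\<close> of hypotheses, a number \<open>x\<close> withheld from \<open>Q\<close> and a
  text along which \<open>M\<close> outputs the members of \<open>K\<close>. On the odd level \<open>2 j - 1\<close> either \<open>K\<close> is empty and \<open>x\<close>
  is the active marker \<open>z\<close> of this level, or \<open>K\<close> has length \<open>j\<close> and all of its members
  have enumerated \<open>x\<close>. On the even level \<open>2 j\<close> the list has length \<open>j + 1\<close> and all of its members except
  possibly the first one have enumerated \<open>x\<close>.

  A state consists of the bound \<open>k\<close> on the hypotheses of \<open>M\<close>, a bound \<open>m\<close> on all numbers used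
  so far, the current text and the list of entries; the part of \<open>Q\<close> enumerated so far consists of
  the numbers below \<open>m\<close> that are not withheld.
\<close>

type_synonym entry = "nat \<times> nat list \<times> nat \<times> nat list"
type_synonym state = "nat \<times> nat \<times> nat list \<times> entry list"

definition lev :: "entry \<Rightarrow> nat" where "lev en = fst en"
definition key :: "entry \<Rightarrow> nat list" where "key en = fst (snd en)"
definition val :: "entry \<Rightarrow> nat" where "val en = fst (snd (snd en))"
definition etxt :: "entry \<Rightarrow> nat list" where "etxt en = snd (snd (snd en))"

definition cap :: "state \<Rightarrow> nat" where "cap st = fst st"
definition bnd :: "state \<Rightarrow> nat" where "bnd st = fst (snd st)"
definition stxt :: "state \<Rightarrow> nat list" where "stxt st = fst (snd (snd st))"
definition ents :: "state \<Rightarrow> entry list" where "ents st = snd (snd (snd st))"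

lemma entry_sel [simp]: "lev (l, K, x, s) = l" "key (l, K, x, s) = K" "val (l, K, x, s) = x"
    "etxt (l, K, x, s) = s"
  by (simp_all add: lev_def key_def val_def etxt_def)

lemma state_sel [simp]: "cap (k, m, s, E) = k" "bnd (k, m, s, E) = m" "stxt (k, m, s, E) = s"
    "ents (k, m, s, E) = E"
  by (simp_all add: cap_def bnd_def stxt_def ents_def)

definition vals :: "state \<Rightarrow> nat set" where "vals st = val ` set (ents st)"

definition inQ :: "state \<Rightarrow> nat \<Rightarrow> bool" where
  "inQ st y \<longleftrightarrow> y < bnd st \<and> y \<notin> vals st"

text \<open>The active markers of level \<open>l\<close>; the empty list is what distinguishes a
  marker from a withheld witness.\<close>

definition zvals :: "state \<Rightarrow> nat \<Rightarrow> nat set" where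
  "zvals st l = {val en | en. en \<in> set (ents st) \<and> lev en = l \<and> key en = []}"

text \<open>The sum of the text dominates each of its elements, so numbers from here on are new to
  the state, to the witness and to the text.\<close>

definition fresh :: "state \<Rightarrow> entry \<Rightarrow> nat" where
  "fresh st ev = Suc (bnd st + val ev + sum_list (etxt ev))"

definition new_cap :: "state \<Rightarrow> entry \<Rightarrow> nat" where
  "new_cap st ev = (if 2 * cap st < lev ev then Suc (cap st) else cap st)"

text \<open>
  An event of level \<open>l\<close> releases everything withheld on lower levels and provides them with fresh
  markers. On even levels every \<open>K\<close> occurs at most once, so that only finitely many numbers
  are withheld there. A level above \<open>2 k\<close> means that a hypothesis \<open>\<ge> k\<close> was found.
\<close>

definition new_ents :: "state \<Rightarrow> entry \<Rightarrow> entry list" where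
  "new_ents st ev =
     map (\<lambda>i. (Suc (2 * i), [], fresh st ev + i, []))
       [0..<(if 2 * cap st < lev ev then Suc (cap st) else lev ev div 2)] @
     (if lev ev \<le> 2 * cap st \<and>
         (odd (lev ev) \<or> \<not> (\<exists>en\<in>set (ents st). lev en = lev ev \<and> key en = key ev))
      then [ev] else []) @
     filter (\<lambda>en. lev ev \<le> lev en) (ents st)"

text \<open>Leaves room for the fresh markers, whose offsets from \<open>fresh\<close> stay below
  the new cap.\<close>

definition new_bnd :: "state \<Rightarrow> entry \<Rightarrow> nat" where
  "new_bnd st ev = Suc (fresh st ev + new_cap st ev)"

text \<open>The new text continues that of the event and then lists everything in \<open>Q\<close>
  so far. A chain of such texts therefore exhausts \<open>Q\<close> in the limit.\<close>

definition apply_event :: "state \<Rightarrow> entry \<Rightarrow> state" where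
  "apply_event st ev = (new_cap st ev, new_bnd st ev,
     etxt ev @ filter (\<lambda>y. \<not> (\<exists>en\<in>set (new_ents st ev). val en = y)) [0..<new_bnd st ev],
     new_ents st ev)"

text \<open>
  At time \<open>t\<close> only the event described by \<open>descr t\<close> is considered; every description is considered
  infinitely often.
\<close>

type_synonym descr = "nat \<times> entry \<times> nat list \<times> nat"

definition descr :: "nat \<Rightarrow> descr" where
  "descr t = inv code (fst (prod_decode t))"

lemma surj_code_descr: "surj (code :: descr \<Rightarrow> nat)"
  by (intro surj_code_prod surj_code_list surj_code_nat)

lemma descr_recurs: "\<exists>t\<ge>t0. descr t = d"
proof (intro exI conjI)
  show "t0 \<le> prod_encode (code d, t0)" by (rule le_prod_encode_2)
  have "inv code (code d) = d" by (rule inv_f_f[OF inj_code])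
  then show "descr (prod_encode (code d, t0)) = d" by (simp add: descr_def)
qed

definition column :: "nat \<Rightarrow> nat list \<Rightarrow> nat list" where
  "column e = map (\<lambda>y. prod_encode (e, y))"

text \<open>\<open>h\<close> will enumerate all pairs of an index and an element of its set, and
  \<open>e\<close> will be an index of the graph of the learner. Then \<open>guess\<close> and
  \<open>enum\<close> say what has been revealed of outputs and hypotheses by time
  \<open>t\<close>.\<close>

locale diag =
  fixes h :: "nat \<Rightarrow> nat" and e :: nat
begin

definition wit :: "nat \<Rightarrow> nat \<Rightarrow> bool" where
  "wit t y \<longleftrightarrow> (\<exists>u<t. h u = y)"

definition guess :: "nat \<Rightarrow> nat list \<Rightarrow> nat \<Rightarrow> bool" where
  "guess t s a \<longleftrightarrow> wit t (prod_encode (e, prod_encode (code (column e s), a)))"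

definition enum :: "nat \<Rightarrow> nat \<Rightarrow> nat \<Rightarrow> bool" where
  "enum t a x \<longleftrightarrow> wit t (prod_encode (a, prod_encode (e, x)))"

text \<open>\<open>c\<close> is the kind of event: 0 starts a list with a hypothesis
  \<open>a\<close> containing the new witness \<open>val en\<close>; 1 adds a hypothesis
  \<open>a\<close> not yet seen to contain the witness of \<open>en\<close>; any other value records
  that the head of the list has enumerated it. The text grows by \<open>r\<close>. A hypothesis not
  below the cap leads to the level just above all entries.\<close>

definition event :: "state \<Rightarrow> descr \<Rightarrow> entry" where
  "event st d = (case d of (c, en, r, a) \<Rightarrow>
     if c = 0 then (if cap st \<le> a then Suc (2 * cap st) else 1, [a], val en, stxt st @ r)
     else if c = 1 then (if cap st \<le> a then Suc (2 * cap st) else Suc (lev en), a # key en, val en, etxt en @ r)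
     else (Suc (lev en), key en, val en, etxt en))"

text \<open>When a list is prolonged, \<open>r\<close> may use the active markers of its level
  besides \<open>Q\<close>, because an event one level up releases them. The condition
  \<open>\<not> enum t a (val en)\<close> only concerns time \<open>t\<close>; if \<open>a\<close>
  enumerates the witness later, the third kind of event becomes possible.\<close>

definition trigger :: "nat \<Rightarrow> state \<Rightarrow> descr \<Rightarrow> bool" where
  "trigger t st d \<longleftrightarrow> (case d of (c, en, r, a) \<Rightarrow>
     if c = 0 then
       bnd st \<le> val en \<and> \<not> (\<exists>en'\<in>set (ents st). val en' = val en) \<and> \<not> val en \<in> set r \<and>
       (\<forall>y\<in>set r. \<not> (\<exists>en'\<in>set (ents st). val en' = y)) \<and>
       guess t (stxt st @ r) a \<and> enum t a (val en)
     else if c = 1 then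
       en \<in> set (ents st) \<and> odd (lev en) \<and> \<not> key en = [] \<and>
       (\<forall>y\<in>set r. (y < bnd st \<and> \<not> (\<exists>en'\<in>set (ents st). val en' = y)) \<or>
          (\<exists>en'\<in>set (ents st). lev en' = lev en \<and> key en' = [] \<and> val en' = y)) \<and>
       guess t (etxt en @ r) a \<and> (cap st \<le> a \<or> \<not> enum t a (val en))
     else en \<in> set (ents st) \<and> even (lev en) \<and> key en = a # tl (key en) \<and> enum t a (val en))"

text \<open>Cap 1 already calls for a marker on level 1: the number 0, just below the bound.\<close>

definition init :: state where
  "init = (1, 1, [], [(1, [], 0, [])])"

definition step :: "nat \<Rightarrow> state \<Rightarrow> state" where
  "step t st = (if trigger t st (descr t) then apply_event st (event st (descr t)) else st)"

definition run :: "nat \<Rightarrow> state" where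
  "run n = rec_nat init step n"

definition fires :: "nat \<Rightarrow> entry \<Rightarrow> bool" where
  "fires t ev \<longleftrightarrow> trigger t (run t) (descr t) \<and> ev = event (run t) (descr t)"

text \<open>Level 0 stands for an idle step, since all events have positive level.\<close>

definition lv :: "nat \<Rightarrow> nat" where
  "lv t = (if trigger t (run t) (descr t) then lev (event (run t) (descr t)) else 0)"

lemma run_0: "run 0 = init" and run_Suc: "run (Suc t) = step t (run t)"
  by (simp_all add: run_def)

lemma wit_mono: "wit t y \<Longrightarrow> t \<le> t' \<Longrightarrow> wit t' y"
  unfolding wit_def by force

lemma enum_mono: "enum t a x \<Longrightarrow> t \<le> t' \<Longrightarrow> enum t' a x"
  unfolding enum_def by (rule wit_mono)

lemma guess_mono: "guess t s a \<Longrightarrow> t \<le> t' \<Longrightarrow> guess t' s a"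
  unfolding guess_def by (rule wit_mono)

lemma fires_step: "fires t ev \<Longrightarrow> run (Suc t) = apply_event (run t) ev"
  by (simp add: fires_def run_Suc step_def)

lemma fires_lv: "fires t ev \<Longrightarrow> lv t = lev ev"
  by (simp add: fires_def lv_def)

lemma lev_event_pos: "lev (event st d) > 0"
  by (cases d) (auto simp: event_def)

lemma lv_pos: "lv t > 0 \<Longrightarrow> \<exists>ev. fires t ev"
  by (auto simp: fires_def lv_def split: if_splits)

lemma lv_0: "lv t = 0 \<Longrightarrow> run (Suc t) = run t"
  using lev_event_pos[of "run t" "descr t"] by (auto simp: lv_def run_Suc step_def split: if_splits)

lemma fires_cases [consumes 1, case_names search branch close]:
  assumes "fires t ev"
  obtains x r a where "bnd (run t) \<le> x" "x \<notin> vals (run t)" "x \<notin> set r" "set r \<inter> vals (run t) = {}"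
      "guess t (stxt (run t) @ r) a" "enum t a x"
      "ev = (if cap (run t) \<le> a then Suc (2 * cap (run t)) else 1, [a], x, stxt (run t) @ r)"
  | en r a where "en \<in> set (ents (run t))" "odd (lev en)" "key en \<noteq> []"
      "\<And>y. y \<in> set r \<Longrightarrow> inQ (run t) y \<or> y \<in> zvals (run t) (lev en)"
      "guess t (etxt en @ r) a" "cap (run t) \<le> a \<or> \<not> enum t a (val en)"
      "ev = (if cap (run t) \<le> a then Suc (2 * cap (run t)) else Suc (lev en), a # key en, val en, etxt en @ r)"
  | en a K where "en \<in> set (ents (run t))" "even (lev en)" "key en = a # K" "enum t a (val en)"
      "ev = (Suc (lev en), key en, val en, etxt en)"
proof -
  obtain c en r a where d: "descr t = (c, en, r, a)" by (cases "descr t") auto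
  have tr: "trigger t (run t) (c, en, r, a)" and ev: "ev = event (run t) (c, en, r, a)"
    using assms d by (auto simp: fires_def)
  consider "c = 0" | "c = 1" | "c \<noteq> 0" "c \<noteq> 1" by blast
  then show ?thesis
  proof cases
    case 1
    then show ?thesis using tr ev
      by (intro that(1)[of "val en" r a]) (auto simp: trigger_def event_def vals_def)
  next
    case 2
    then show ?thesis using tr ev
      by (intro that(2)[of en r a]) (auto simp: trigger_def event_def vals_def inQ_def zvals_def)
  next
    case 3
    then show ?thesis using tr ev
      by (intro that(3)[of en a "tl (key en)"]) (auto simp: trigger_def event_def)
  qed
qed

section \<open>The invariant of the construction\<close>

definition wf_entry :: "nat \<Rightarrow> state \<Rightarrow> entry \<Rightarrow> bool" where
  "wf_entry t st en \<longleftrightarrow> 0 < lev en \<and> lev en \<le> 2 * cap st \<and> val en < bnd st \<and>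
     (\<forall>y\<in>set (etxt en). inQ st y) \<and> (key en = [] \<longrightarrow> odd (lev en)) \<and>
     (key en \<noteq> [] \<longrightarrow> length (key en) = Suc (lev en div 2) \<and> distinct (key en) \<and>
        (\<forall>a\<in>set (key en). a < cap st) \<and>
        (\<forall>a\<in>set (if odd (lev en) then key en else tl (key en)). enum t a (val en)))"

text \<open>Injectivity of \<open>val\<close> means that each number is withheld by one entry only,
  so witnesses and markers are never confused.\<close>

definition wf_state :: "nat \<Rightarrow> state \<Rightarrow> bool" where
  "wf_state t st \<longleftrightarrow> 0 < cap st \<and> (\<forall>en\<in>set (ents st). wf_entry t st en) \<and>
     (\<forall>y\<in>set (stxt st). inQ st y) \<and> inj_on val (set (ents st)) \<and>
     (\<forall>i<cap st. \<exists>en\<in>set (ents st). lev en = Suc (2 * i) \<and> key en = []) \<and>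
     (\<forall>en\<in>set (ents st). \<forall>en'\<in>set (ents st). even (lev en) \<longrightarrow> lev en = lev en' \<longrightarrow>
        key en = key en' \<longrightarrow> en = en')"

lemma distinct_key_length:
  assumes "distinct K" "\<forall>a\<in>set K. a < (k::nat)"
  shows "length K \<le> k"
proof -
  have "card (set K) \<le> card {..<k}" by (rule card_mono) (use assms in auto)
  then show ?thesis using assms by (simp add: distinct_card)
qed

text \<open>What preserves the invariant, whatever the kind of event. A witness is either new or
  passed on from a lower level, whose entry is then dropped, so that it is never withheld
  twice.\<close>

definition good_event :: "nat \<Rightarrow> state \<Rightarrow> entry \<Rightarrow> bool" where
  "good_event t st ev \<longleftrightarrow> 0 < lev ev \<and> lev ev \<le> Suc (2 * cap st) \<and> key ev \<noteq> [] \<and>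
     (bnd st \<le> val ev \<and> val ev \<notin> vals st \<or> (\<exists>en\<in>set (ents st). key en \<noteq> [] \<and> val en = val ev \<and> lev en < lev ev)) \<and>
     (\<forall>y\<in>set (etxt ev). y \<noteq> val ev \<and> (\<forall>en\<in>set (ents st). lev ev \<le> lev en \<longrightarrow> val en \<noteq> y)) \<and>
     (lev ev \<le> 2 * cap st \<longrightarrow> length (key ev) = Suc (lev ev div 2) \<and> distinct (key ev) \<and>
        (\<forall>a\<in>set (key ev). a < cap st) \<and>
        (\<forall>a\<in>set (if odd (lev ev) then key ev else tl (key ev)). enum t a (val ev)))"

lemma good_event_fires:
  assumes wf: "wf_state t (run t)" and f: "fires t ev"
  shows "good_event t (run t) ev"
    and "2 * cap (run t) < lev ev \<Longrightarrow> \<exists>a \<ge> cap (run t). guess t (etxt ev) a"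
proof -
  let ?st = "run t"
  have we: "wf_entry t ?st en" if "en \<in> set (ents ?st)" for en
    using wf that by (auto simp: wf_state_def)
  have inj: "en = en'" if "en \<in> set (ents ?st)" "en' \<in> set (ents ?st)" "val en = val en'" for en en'
    using wf that by (auto simp: wf_state_def inj_on_def)
  have st: "inQ ?st y" if "y \<in> set (stxt ?st)" for y
    using wf that by (auto simp: wf_state_def)
  have c0: "0 < cap ?st" using wf by (simp add: wf_state_def)
  have "good_event t ?st ev \<and> (2 * cap ?st < lev ev \<longrightarrow> (\<exists>a \<ge> cap ?st. guess t (etxt ev) a))"
    using f
  proof (cases rule: fires_cases)
    case (search x r a)
    have y: "y \<noteq> x \<and> (\<forall>en\<in>set (ents ?st). val en \<noteq> y)" if "y \<in> set (stxt ?st @ r)" for y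
      using that st[of y] search(1-4) by (auto simp: inQ_def vals_def)
    show ?thesis using search c0 y by (auto simp: good_event_def)
  next
    case (branch en r a)
    have w: "wf_entry t ?st en" using we branch by blast
    have "lev en \<le> 2 * cap ?st" using w by (simp add: wf_entry_def)
    then have odd: "Suc (lev en) \<le> 2 * cap ?st" using branch(2) by presburger
    have y: "y \<noteq> val en \<and> (\<forall>en'\<in>set (ents ?st). lev en < lev en' \<longrightarrow> val en' \<noteq> y)"
      if "y \<in> set (etxt en @ r)" for y
    proof -
      have "inQ ?st y \<or> y \<in> zvals ?st (lev en)" using that branch(4)[of y] w by (auto simp: wf_entry_def)
      then show ?thesis
      proof
        assume "inQ ?st y"
        then show ?thesis using branch(1) by (auto simp: inQ_def vals_def)
      next
        assume "y \<in> zvals ?st (lev en)"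
        then obtain en2 where e2: "en2 \<in> set (ents ?st)" "lev en2 = lev en" "key en2 = []" "val en2 = y"
          by (auto simp: zvals_def)
        have "val en2 \<noteq> val en" using inj[OF e2(1) branch(1)] e2(3) branch(3) by metis
        moreover have "val en' \<noteq> y" if "en' \<in> set (ents ?st)" "lev en < lev en'" for en'
          using inj[OF e2(1) that(1)] e2(2,4) that(2) by (metis less_irrefl)
        ultimately show ?thesis using e2(4) by blast
      qed
    qed
    have hd: "(Suc (lev en)) div 2 = Suc (lev en div 2)" using branch(2) by presburger
    \<comment> \<open>All members of a list on an odd level have enumerated the witness and
      \<open>a\<close> has not, so the prolonged list stays distinct.\<close>
    have a: "a \<notin> set (key en)" if "a < cap ?st"
      using that branch(2,3,6) w by (auto simp: wf_entry_def)
    show ?thesis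
    proof (cases "cap ?st \<le> a")
      case True
      then show ?thesis using branch y odd by (auto simp: good_event_def)
    next
      case False
      then show ?thesis using branch y odd hd a w by (auto simp: good_event_def wf_entry_def)
    qed
  next
    case (close en a K)
    have w: "wf_entry t ?st en" using we close by blast
    \<comment> \<open>Pigeonhole: a distinct list of hypotheses below the cap is no longer than the
      cap, so an event of this kind never exceeds the top level \<open>2 * cap\<close>.\<close>
    have "length (key en) \<le> cap ?st"
      using w close(3) by (intro distinct_key_length) (auto simp: wf_entry_def)
    then have "lev en div 2 < cap ?st" using w close(3) by (auto simp: wf_entry_def)
    then have lt: "Suc (lev en) \<le> 2 * cap ?st" using close(2) by presburger
    have "y \<noteq> val en \<and> (\<forall>en'\<in>set (ents ?st). val en' \<noteq> y)" if "y \<in> set (etxt en)" for y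
      using that w close(1) by (auto simp: wf_entry_def inQ_def vals_def)
    moreover have "Suc (lev en) div 2 = lev en div 2" using close(2) by presburger
    moreover have "\<exists>en'\<in>set (ents ?st). key en' \<noteq> [] \<and> val en' = val en \<and> lev en' < Suc (lev en)"
      using close by (intro bexI[of _ en]) auto
    ultimately show ?thesis using close w lt by (auto simp: good_event_def wf_entry_def)
  qed
  then show "good_event t ?st ev"
    and "2 * cap ?st < lev ev \<Longrightarrow> \<exists>a \<ge> cap ?st. guess t (etxt ev) a" by auto
qed

lemma ents_apply_event:
  "set (ents (apply_event st ev)) =
     {(Suc (2 * i), [], fresh st ev + i, []) | i. i < (if 2 * cap st < lev ev then Suc (cap st) else lev ev div 2)} \<union>
     {ev' . ev' = ev \<and> lev ev \<le> 2 * cap st \<and>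
         (odd (lev ev) \<or> \<not> (\<exists>en\<in>set (ents st). lev en = lev ev \<and> key en = key ev))} \<union>
     {en \<in> set (ents st). lev ev \<le> lev en}"
  by (auto simp: apply_event_def new_ents_def)

lemma in_ents_apply_event:
  assumes "en \<in> set (ents (apply_event st ev))"
  obtains (zero) i where "en = (Suc (2 * i), [], fresh st ev + i, [])"
      "i < (if 2 * cap st < lev ev then Suc (cap st) else lev ev div 2)"
  | (new) "en = ev" "lev ev \<le> 2 * cap st"
      "odd (lev ev) \<or> \<not> (\<exists>en\<in>set (ents st). lev en = lev ev \<and> key en = key ev)"
  | (old) "en \<in> set (ents st)" "lev ev \<le> lev en"
  using assms unfolding ents_apply_event by blast

lemma apply_event_sel:
  "cap (apply_event st ev) = new_cap st ev" "bnd (apply_event st ev) = new_bnd st ev"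
  by (simp_all add: apply_event_def)

text \<open>After an event, numbers are withheld only as fresh markers, as its witness, or by old
  entries of at least its level.\<close>

lemma inQ_apply_event:
  assumes g: "good_event t st ev" and y: "y < fresh st ev" "y \<noteq> val ev"
    "\<forall>en\<in>set (ents st). lev ev \<le> lev en \<longrightarrow> val en \<noteq> y"
  shows "inQ (apply_event st ev) y"
proof -
  have "val en \<noteq> y" if "en \<in> set (ents (apply_event st ev))" for en
    using that y by (cases rule: in_ents_apply_event) auto
  then show ?thesis using y unfolding inQ_def apply_event_sel vals_def by (auto simp: new_bnd_def)
qed

lemma inQ_mono_apply_event:
  assumes g: "good_event t st ev" and y: "inQ st y"
  shows "inQ (apply_event st ev) y"
proof (rule inQ_apply_event[OF g])
  show "y < fresh st ev" using y by (simp add: inQ_def fresh_def)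
  show "y \<noteq> val ev" using y g unfolding inQ_def good_event_def vals_def
    by (metis image_eqI linorder_not_le)
  show "\<forall>en\<in>set (ents st). lev ev \<le> lev en \<longrightarrow> val en \<noteq> y" using y by (auto simp: inQ_def vals_def)
qed

lemma etxt_inQ_apply_event:
  assumes g: "good_event t st ev" and y: "y \<in> set (etxt ev)"
  shows "inQ (apply_event st ev) y"
proof (rule inQ_apply_event[OF g])
  show "y < fresh st ev" using member_le_sum_list[OF y] by (simp add: fresh_def)
qed (use g y in \<open>auto simp: good_event_def\<close>)

lemma stxt_apply_event:
  "set (stxt (apply_event st ev)) = set (etxt ev) \<union> {y. inQ (apply_event st ev) y}"
  by (auto simp: apply_event_def inQ_def vals_def)

lemma wf_state_apply_event:
  assumes wf: "wf_state t st" and g: "good_event t st ev"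
  shows "wf_state t (apply_event st ev)"
proof -
  let ?st = "apply_event st ev"
  let ?b = "fresh st ev"
  have we: "wf_entry t st en" if "en \<in> set (ents st)" for en
    using wf that by (auto simp: wf_state_def)
  have cap: "cap st \<le> cap ?st" by (simp add: apply_event_sel new_cap_def)
  have bnd: "val ev < ?b" "bnd st < ?b" "?b + cap ?st < bnd ?st"
    by (simp_all add: apply_event_sel new_bnd_def fresh_def)
  have val_b: "val en < ?b" if "en \<in> set (ents st)" for en
    using we[OF that] bnd by (auto simp: wf_entry_def)
  have z: "i < cap ?st \<and> Suc (2 * i) \<le> 2 * cap ?st \<and> (lev ev \<le> 2 * cap st \<longrightarrow> Suc (2 * i) < lev ev)"
    if "i < (if 2 * cap st < lev ev then Suc (cap st) else lev ev div 2)" for i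
    using that by (auto simp: apply_event_sel new_cap_def split: if_splits)
  have 1: "wf_entry t ?st en" if "en \<in> set (ents ?st)" for en
    using that
  proof (cases rule: in_ents_apply_event)
    case (zero i)
    then show ?thesis using z[of i] bnd by (auto simp: wf_entry_def)
  next
    case new
    have "val ev < bnd ?st" using bnd by linarith
    then show ?thesis using new g cap etxt_inQ_apply_event[OF g]
      by (auto simp: wf_entry_def good_event_def dest: le_trans less_le_trans)
  next
    case old
    have "val en < bnd ?st" using bnd val_b[OF old(1)] by linarith
    then show ?thesis using we[OF old(1)] inQ_mono_apply_event[OF g] cap
      by (auto simp: wf_entry_def intro: less_le_trans)
  qed
  have 2: "inj_on val (set (ents ?st))"
  proof (rule inj_onI)
    fix en en' assume *: "en \<in> set (ents ?st)" "en' \<in> set (ents ?st)" "val en = val en'"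
    have inj: "en1 = en2" if "en1 \<in> set (ents st)" "en2 \<in> set (ents st)" "val en1 = val en2" for en1 en2
      using wf that by (auto simp: wf_state_def inj_on_def)
    \<comment> \<open>If the witness of the event was withheld before, then by an entry of lower
      level and, by injectivity, by no other; that entry does not survive.\<close>
    have ev: "val en1 \<noteq> val ev" if "en1 \<in> set (ents st)" "lev ev \<le> lev en1" for en1
    proof
      assume eq: "val en1 = val ev"
      then have "val ev \<in> vals st" using that(1) by (metis imageI vals_def)
      then obtain en2 where "en2 \<in> set (ents st)" "val en2 = val ev" "lev en2 < lev ev"
        using g by (auto simp: good_event_def)
      then show False using inj[OF that(1)] eq that(2) by (metis linorder_not_le)
    qed
    from *(1) show "en = en'"
    proof (cases rule: in_ents_apply_event)
      case (zero i)
      from *(2) show ?thesis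
      proof (cases rule: in_ents_apply_event)
        case zero2: (zero j)
        then show ?thesis using zero *(3) by simp
      next
        case new
        then show ?thesis using zero *(3) bnd by simp
      next
        case old
        then show ?thesis using zero *(3) val_b[OF old(1)] by simp
      qed
    next
      case new
      from *(2) show ?thesis
      proof (cases rule: in_ents_apply_event)
        case (zero j)
        then show ?thesis using new *(3) bnd by simp
      next
        case new2: new
        then show ?thesis using new by simp
      next
        case old
        then show ?thesis using new *(3) ev[OF old] by simp
      qed
    next
      case old
      from *(2) show ?thesis
      proof (cases rule: in_ents_apply_event)
        case (zero i)
        then show ?thesis using val_b[OF old(1)] *(3) by simp
      next
        case new
        then show ?thesis using ev[OF old] *(3) by simp
      next
        case old2: old
        show ?thesis by (rule inj[OF old(1) old2(1) *(3)])
      qed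
    qed
  qed
  \<comment> \<open>Odd levels below that of the event get fresh markers and the others keep theirs;
    a raised cap renews all of them.\<close>
  have 3: "\<exists>en\<in>set (ents ?st). lev en = Suc (2 * i) \<and> key en = []" if i: "i < cap ?st" for i
  proof (cases "i < (if 2 * cap st < lev ev then Suc (cap st) else lev ev div 2)")
    case True
    then have "(Suc (2 * i), [], ?b + i, []) \<in> set (ents ?st)" unfolding ents_apply_event by blast
    then show ?thesis by (rule bexI[rotated]) simp
  next
    case False
    then have *: "\<not> 2 * cap st < lev ev" "lev ev div 2 \<le> i" "i < cap st"
      using i by (auto simp: apply_event_sel new_cap_def split: if_splits)
    then obtain en where en: "en \<in> set (ents st)" "lev en = Suc (2 * i)" "key en = []"
      using wf by (auto simp: wf_state_def)
    have "lev ev \<le> lev en" using * en by presburger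
    then show ?thesis using en unfolding ents_apply_event by blast
  qed
  have 4: "en = en'" if "en \<in> set (ents ?st)" "en' \<in> set (ents ?st)" "even (lev en)"
    "lev en = lev en'" "key en = key en'" for en en'
    using that(1)
  proof (cases rule: in_ents_apply_event)
    case (zero i)
    then show ?thesis using that by auto
  next
    case new
    from that(2) show ?thesis
      by (cases rule: in_ents_apply_event) (use new that in auto)
  next
    case old
    from that(2) show ?thesis
    proof (cases rule: in_ents_apply_event)
      case (zero i)
      then show ?thesis using that by auto
    next
      case new
      then show ?thesis using that old by auto
    next
      case old2: old
      then show ?thesis using old that wf unfolding wf_state_def by blast
    qed
  qed
  have 5: "inQ ?st y" if "y \<in> set (stxt ?st)" for y
    using that etxt_inQ_apply_event[OF g] unfolding stxt_apply_event by blast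
  have "0 < cap ?st" using wf cap by (auto simp: wf_state_def)
  then show ?thesis unfolding wf_state_def using 1 2 3 4 5 by blast
qed

lemma wf_entry_mono: "wf_entry t st en \<Longrightarrow> t \<le> t' \<Longrightarrow> wf_entry t' st en"
  unfolding wf_entry_def using enum_mono by blast

lemma wf_state_mono: "wf_state t st \<Longrightarrow> t \<le> t' \<Longrightarrow> wf_state t' st"
  unfolding wf_state_def by (blast intro: wf_entry_mono)

lemma wf_run: "wf_state t (run t)"
proof (induction t)
  case 0
  show ?case by (auto simp: run_0 init_def wf_state_def wf_entry_def)
next
  case (Suc t)
  show ?case
  proof (cases "lv t = 0")
    case True
    then show ?thesis using Suc lv_0 wf_state_mono[of t _ "Suc t"] by simp
  next
    case False
    then obtain ev where ev: "fires t ev" using lv_pos by blast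
    have "wf_state t (run (Suc t))"
      unfolding fires_step[OF ev] by (rule wf_state_apply_event[OF Suc good_event_fires(1)[OF Suc ev]])
    then show ?thesis by (rule wf_state_mono) simp
  qed
qed

lemmas good_event = good_event_fires(1)[OF wf_run]
lemmas super_event = good_event_fires(2)[OF wf_run]

end

text \<open>Induction on the bound: either the bound itself recurs, or it can be lowered by one from
  some point on.\<close>

lemma limsup_attained:
  fixes f :: "nat \<Rightarrow> nat"
  assumes "\<forall>t\<ge>T. f t \<le> B"
  shows "\<exists>L T'. T \<le> T' \<and> (\<forall>t\<ge>T'. f t \<le> L) \<and> (\<forall>n. \<exists>t\<ge>n. f t = L) \<and> L \<le> B"
  using assms
proof (induction B arbitrary: T)
  case 0
  then have "(\<forall>t\<ge>T. f t \<le> 0) \<and> (\<forall>n. \<exists>t\<ge>n. f t = 0)"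
    by (metis le_zero_eq nat_le_linear)
  then show ?case by blast
next
  case (Suc B)
  show ?case
  proof (cases "\<forall>n. \<exists>t\<ge>n. f t = Suc B")
    case True
    then show ?thesis using Suc.prems by blast
  next
    case False
    then obtain n where n: "\<forall>t\<ge>n. f t \<noteq> Suc B" by blast
    then have "\<forall>t\<ge>max n T. f t \<le> B"
      using Suc.prems by (metis le_SucE max.bounded_iff)
    from Suc.IH[OF this] show ?thesis by (meson le_SucI max.bounded_iff)
  qed
qed

section \<open>Monotonicity and persistence along the run\<close>

context diag
begin

lemma step_cases:
  obtains (idle) "lv t = 0" "run (Suc t) = run t"
  | (event) ev where "fires t ev" "lev ev = lv t" "run (Suc t) = apply_event (run t) ev"
  using lv_0 lv_pos fires_step fires_lv by (metis gr0I)

lemma wf_entry_run: "en \<in> set (ents (run t)) \<Longrightarrow> wf_entry t (run t) en"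
  using wf_run[of t] by (simp add: wf_state_def)

lemma val_inj_run:
  "en \<in> set (ents (run t)) \<Longrightarrow> en' \<in> set (ents (run t)) \<Longrightarrow> val en = val en' \<Longrightarrow> en = en'"
  using wf_run[of t] by (auto simp: wf_state_def inj_on_def)

lemma val_in_vals: "en \<in> set (ents st) \<Longrightarrow> val en \<in> vals st"
  by (metis imageI vals_def)

lemma finite_vals: "finite (vals st)"
  by (simp add: vals_def)

lemma zvals_subset: "zvals st l \<subseteq> vals st"
  unfolding zvals_def vals_def by blast

lemma cap_pos: "0 < cap (run t)"
  using wf_run[of t] by (simp add: wf_state_def)

lemma inQ_Suc: "inQ (run t) y \<Longrightarrow> inQ (run (Suc t)) y"
  by (cases t rule: step_cases) (use inQ_mono_apply_event[OF good_event] in auto)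

lemma inQ_mono: "t \<le> t' \<Longrightarrow> inQ (run t) y \<Longrightarrow> inQ (run t') y"
  by (induction rule: dec_induct) (auto intro: inQ_Suc)

lemma bnd_Suc: "bnd (run t) \<le> bnd (run (Suc t))" "0 < lv t \<Longrightarrow> bnd (run t) < bnd (run (Suc t))"
  by (cases t rule: step_cases; simp add: apply_event_sel new_bnd_def fresh_def)+

lemma bnd_mono: "t \<le> t' \<Longrightarrow> bnd (run t) \<le> bnd (run t')"
  by (rule lift_Suc_mono_le[of "\<lambda>t. bnd (run t)"]) (auto intro: bnd_Suc)

lemma cap_Suc: "cap (run (Suc t)) = (if 2 * cap (run t) < lv t then Suc (cap (run t)) else cap (run t))"
  by (cases t rule: step_cases) (auto simp: apply_event_sel new_cap_def)

lemma cap_mono: "t \<le> t' \<Longrightarrow> cap (run t) \<le> cap (run t')"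
  by (rule lift_Suc_mono_le[of "\<lambda>t. cap (run t)"]) (auto simp: cap_Suc)

lemma bnd_unbounded:
  assumes "\<forall>n. \<exists>t\<ge>n. 0 < lv t"
  shows "\<exists>n. \<forall>t\<ge>n. y < bnd (run t)"
proof (induction y)
  case 0
  obtain t where "0 < lv t" using assms by blast
  then show ?case using bnd_Suc(2)[of t] bnd_mono[of "Suc t"] by (metis less_le_trans not_gr0 not_less0)
next
  case (Suc y)
  then obtain n where n: "\<forall>t\<ge>n. y < bnd (run t)" by blast
  obtain t where "t \<ge> n" "0 < lv t" using assms by blast
  then show ?case using bnd_Suc(2)[of t] bnd_mono[of "Suc t"] n
    by (metis Suc_leI le_less_trans less_le_trans)
qed

lemma cap_unbounded:
  assumes "\<forall>n. \<exists>t\<ge>n. 2 * cap (run t) < lv t"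
  shows "\<exists>n. \<forall>t\<ge>n. y < cap (run t)"
proof (induction y)
  case 0
  show ?case using cap_pos by blast
next
  case (Suc y)
  then obtain n where n: "\<forall>t\<ge>n. y < cap (run t)" by blast
  obtain t where "t \<ge> n" "2 * cap (run t) < lv t" using assms by blast
  then show ?case using cap_Suc[of t] cap_mono[of "Suc t"] n
    by (metis Suc_less_eq less_le_trans)
qed

text \<open>An event removes only entries below its own level.\<close>

lemma entry_persists:
  assumes "t \<le> t'" "en \<in> set (ents (run t))" "L \<le> lev en" "\<And>u. t \<le> u \<Longrightarrow> u < t' \<Longrightarrow> lv u \<le> L"
  shows "en \<in> set (ents (run t'))"
  using assms
proof (induction rule: dec_induct)
  case (step n)
  then have en: "en \<in> set (ents (run n))" by simp
  show ?case
  proof (cases n rule: step_cases)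
    case (event ev)
    then have "lev ev \<le> lev en" using step.prems(2) step.prems(3)[of n] step.hyps by simp
    then show ?thesis using en unfolding event(3) ents_apply_event by blast
  qed (use en in simp)
qed simp

text \<open>Converse of persistence: while the cap stands still, an event of level at most
  \<open>L\<close> creates markers strictly below its level and one other entry at its level, hence
  nothing above \<open>L\<close> and no marker on \<open>L\<close>.\<close>

lemma entry_not_new:
  assumes "t \<le> t'" "en \<in> set (ents (run t'))" "L < lev en \<or> L \<le> lev en \<and> key en = []"
    "\<And>u. t \<le> u \<Longrightarrow> u < t' \<Longrightarrow> lv u \<le> L \<and> lv u \<le> 2 * cap (run u)"
  shows "en \<in> set (ents (run t))"
  using assms
proof (induction rule: dec_induct)
  case (step n)
  have n: "lv n \<le> L" "lv n \<le> 2 * cap (run n)" using step.prems(3)[of n] step.hyps by auto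
  have "en \<in> set (ents (run n))"
  proof (cases n rule: step_cases)
    case (event ev)
    from step.prems(1) have "en \<in> set (ents (apply_event (run n) ev))" using event by simp
    then show ?thesis
    proof (cases rule: in_ents_apply_event)
      case (zero i)
      then show ?thesis using n event(2) step.prems(2) by auto
    next
      case new
      then show ?thesis using n event(2) step.prems(2) good_event[OF event(1)] by (auto simp: good_event_def)
    qed
  qed (use step.prems in simp)
  then show ?case using step by simp
qed simp

section \<open>The limit set and the targets\<close>

definition Q :: "nat set" where
  "Q = {y. \<exists>t. inQ (run t) y}"

lemma Q_at: "finite F \<Longrightarrow> F \<subseteq> Q \<Longrightarrow> \<exists>n. \<forall>t\<ge>n. \<forall>y\<in>F. inQ (run t) y"
proof (induction rule: finite_induct)
  case (insert y F)
  then obtain n where n: "\<forall>t\<ge>n. \<forall>y\<in>F. inQ (run t) y" by auto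
  obtain m where "inQ (run m) y" using insert.prems by (auto simp: Q_def)
  then have "\<forall>t\<ge>max n m. \<forall>y\<in>insert y F. inQ (run t) y" using n inQ_mono[of m] by auto
  then show ?case by blast
qed auto

text \<open>
  \<open>A t0 j\<close> is the target of the search on level \<open>2 j\<close> running at time \<open>t0\<close>. As soon as an event of a higher
  level ends this search, the set follows the target of the topmost level instead, so that the
  vacillating learner can identify it in any case.
\<close>

definition alive :: "nat \<Rightarrow> nat \<Rightarrow> nat \<Rightarrow> bool" where
  "alive t0 j t \<longleftrightarrow> j \<le> cap (run t0) \<and> (\<forall>u<t. t0 \<le> u \<longrightarrow> lv u \<le> 2 * j)"

text \<open>For \<open>j = 0\<close> there is no marker level, and a live search aims at everything
  not withheld; the condition \<open>y < t\<close> keeps the set finite at each time.\<close>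

definition member :: "nat \<Rightarrow> nat \<Rightarrow> nat \<Rightarrow> nat \<Rightarrow> bool" where
  "member t0 j t y \<longleftrightarrow> inQ (run t) y \<or>
     (if alive t0 j t then if j = 0 then y < t \<and> y \<notin> vals (run t) else y \<in> zvals (run t) (2 * j - 1)
      else y \<in> zvals (run t) (2 * cap (run t) - 1))"

definition A :: "nat \<Rightarrow> nat \<Rightarrow> nat set" where
  "A t0 j = {y. \<exists>t\<ge>t0. member t0 j t y}"

lemma Q_subset_A: "Q \<subseteq> A t0 j"
proof
  fix y assume "y \<in> Q"
  then obtain t where "inQ (run t) y" by (auto simp: Q_def)
  then have "inQ (run (max t t0)) y" using inQ_mono[of t "max t t0"] by simp
  then show "y \<in> A t0 j" unfolding A_def member_def by (intro CollectI exI[of _ "max t t0"]) simp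
qed

lemma finite_member: "finite {y. member t0 j t y}"
proof -
  have "finite (zvals (run t) l)" for l using finite_subset[OF zvals_subset finite_vals] .
  moreover have "{y. member t0 j t y} \<subseteq> {..<bnd (run t)} \<union> {..<t} \<union> zvals (run t) (2 * j - 1) \<union>
      zvals (run t) (2 * cap (run t) - 1)"
    by (auto simp: member_def inQ_def split: if_splits)
  ultimately show ?thesis by (meson finite_UnI finite_lessThan finite_subset)
qed

section \<open>Possible outcomes of the construction\<close>

definition unsettled :: bool where
  "unsettled \<longleftrightarrow> (\<forall>n. \<exists>t\<ge>n. 2 * cap (run t) < lv t)"

lemma inQ_after_event:
  assumes ev: "fires t ev" and y: "y < bnd (run t)"
    and old: "\<And>en. en \<in> set (ents (run (Suc t))) \<Longrightarrow> lev ev \<le> lev en \<Longrightarrow> lev en \<le> 2 * cap (run t) \<Longrightarrow> val en \<noteq> y"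
  shows "inQ (run (Suc t)) y"
proof -
  have "val en \<noteq> y" if en: "en \<in> set (ents (run (Suc t)))" for en
    using en[unfolded fires_step[OF ev]]
  proof (cases rule: in_ents_apply_event)
    case (zero i)
    then show ?thesis using y by (simp add: fresh_def)
  next
    case new
    then show ?thesis using old[OF en] by simp
  next
    case o: old
    then show ?thesis using old[OF en] wf_entry_run[of en t] by (simp add: wf_entry_def)
  qed
  moreover have "y < bnd (run (Suc t))" using y bnd_Suc(1)[of t] by simp
  ultimately show ?thesis unfolding inQ_def vals_def by auto
qed

text \<open>An event raising the cap lies above all entries and drops them, so every number below
  the current bound enters \<open>Q\<close>; the bounds tend to infinity.\<close>

lemma unsettled_Q:
  assumes "unsettled"
  shows "Q = UNIV"
proof -
  have "y \<in> Q" for y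
  proof -
    have "\<forall>n. \<exists>t\<ge>n. 0 < lv t" using assms unfolding unsettled_def by (metis not_less_zero gr0I)
    then obtain n where n: "\<forall>t\<ge>n. y < bnd (run t)" using bnd_unbounded by blast
    obtain t where t: "t \<ge> n" "2 * cap (run t) < lv t" using assms unfolding unsettled_def by blast
    then obtain ev where ev: "fires t ev" using lv_pos[of t] by auto
    have "inQ (run (Suc t)) y"
      using t n fires_lv[OF ev] by (intro inQ_after_event[OF ev]) auto
    then show ?thesis by (auto simp: Q_def)
  qed
  then show ?thesis by blast
qed

end

text \<open>\<open>k\<close> is the final cap and \<open>L\<close> the limit superior of the event
  levels. The cases \<open>L = 0\<close>, \<open>L\<close> odd and \<open>L\<close> even positive
  are the possible outcomes.\<close>

locale settled = diag +
  fixes T k L :: nat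
  assumes cap_settled: "t \<ge> T \<Longrightarrow> cap (run t) = k"
    and lv_settled: "t \<ge> T \<Longrightarrow> lv t \<le> L"
    and lv_recurs: "\<exists>t\<ge>n. lv t = L"
    and L_le: "L \<le> 2 * k"

lemma (in diag) settledI:
  assumes "\<not> unsettled"
  shows "\<exists>T k L. settled h e T k L"
proof -
  from assms obtain n where n: "\<forall>t\<ge>n. lv t \<le> 2 * cap (run t)"
    unfolding unsettled_def by (metis linorder_not_less)
  have cap: "cap (run t) = cap (run n)" if "n \<le> t" for t
    using that by (induction rule: dec_induct) (use n cap_Suc in auto)
  then have "\<forall>t\<ge>n. lv t \<le> 2 * cap (run n)" using n by metis
  from limsup_attained[OF this] obtain L T where *: "n \<le> T" "\<forall>t\<ge>T. lv t \<le> L" "\<forall>m. \<exists>t\<ge>m. lv t = L"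
    "L \<le> 2 * cap (run n)" by blast
  then have "settled h e T (cap (run n)) L" 
  proof unfold_locales
    fix t assume "T \<le> t"
    then show "cap (run t) = cap (run n)" using cap * le_trans by blast
  qed (use * in auto)
  then show ?thesis by blast
qed

context settled
begin

lemma k_pos: "0 < k"
  using cap_pos[of T] cap_settled[of T] by simp

lemma persists: "T \<le> t \<Longrightarrow> t \<le> t' \<Longrightarrow> en \<in> set (ents (run t)) \<Longrightarrow> L \<le> lev en \<Longrightarrow> en \<in> set (ents (run t'))"
  using entry_persists[of t t' en L] lv_settled by auto

lemma zvals_settled:
  assumes "T \<le> t" "L \<le> l"
  shows "zvals (run t) l = zvals (run T) l"
proof -
  have 1: "lv u \<le> L \<and> lv u \<le> 2 * cap (run u)" if "T \<le> u" for u
    using lv_settled[OF that] cap_settled[OF that] L_le by simp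
  have "en \<in> set (ents (run t)) \<longleftrightarrow> en \<in> set (ents (run T))" if "lev en = l" "key en = []" for en
    using that persists[of T t en] entry_not_new[of T t en L] 1 assms by auto
  then show ?thesis unfolding zvals_def by blast
qed

lemma zvals_nonempty:
  assumes "odd l" "l \<le> 2 * k"
  shows "zvals (run T) l \<noteq> {}"
proof -
  from assms have "l div 2 < cap (run T)" "l = Suc (2 * (l div 2))" using cap_settled[of T] by presburger+
  then obtain en where "en \<in> set (ents (run T))" "lev en = l" "key en = []"
    using wf_run[of T] unfolding wf_state_def by metis
  then show ?thesis unfolding zvals_def by blast
qed

lemma events_unbounded: "0 < L \<Longrightarrow> \<forall>n. \<exists>t\<ge>n. 0 < lv t"
  using lv_recurs by metis

lemma obtain_event:
  assumes "0 < L"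
  obtains t ev where "n \<le> t" "T \<le> t" "fires t ev" "lev ev = L"
proof -
  obtain t where t: "t \<ge> max n T" "lv t = L" using lv_recurs by blast
  then obtain ev where "fires t ev" using lv_pos[of t] assms by auto
  with t that show ?thesis using fires_lv by (metis max.bounded_iff)
qed

text \<open>Only values of entries of level at least \<open>L\<close> can be withheld forever. On
  level \<open>L\<close> the lists are unique, of bounded length and over finitely many hypotheses;
  above \<open>L\<close> nothing new appears after \<open>T\<close>. Any other number is released by
  an event of level \<open>L\<close> once the bound exceeds it.\<close>

lemma even_cofinite:
  assumes L: "even L" "0 < L"
  shows "finite (- Q)"
proof -
  define B where "B = {en. \<exists>t\<ge>T. en \<in> set (ents (run t)) \<and> L \<le> lev en}"
  define B' where "B' = {en \<in> B. lev en = L}"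
  \<comment> \<open>Entries of level at least \<open>L\<close> persist, so any two of them meet in
    one state, where uniqueness of lists applies.\<close>
  have common: "\<exists>t\<ge>T. en \<in> set (ents (run t)) \<and> en' \<in> set (ents (run t))" if "en \<in> B" "en' \<in> B" for en en'
  proof -
    from that obtain t t' where "T \<le> t" "en \<in> set (ents (run t))" "L \<le> lev en"
      "T \<le> t'" "en' \<in> set (ents (run t'))" "L \<le> lev en'" by (auto simp: B_def)
    then show ?thesis using persists[of t "max t t'" en] persists[of t' "max t t'" en']
      by (intro exI[of _ "max t t'"]) auto
  qed
  have "inj_on key B'"
  proof (rule inj_onI)
    fix en en' assume *: "en \<in> B'" "en' \<in> B'" "key en = key en'"
    then obtain t where "en \<in> set (ents (run t))" "en' \<in> set (ents (run t))"
      using common[of en en'] by (auto simp: B'_def)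
    then show "en = en'" using * wf_run[of t] L unfolding wf_state_def B'_def by auto
  qed
  moreover have "key ` B' \<subseteq> {K. set K \<subseteq> {..<k} \<and> length K \<le> Suc k}"
  proof
    fix K assume "K \<in> key ` B'"
    then obtain en t where en: "K = key en" "T \<le> t" "en \<in> set (ents (run t))" "lev en = L"
      by (auto simp: B'_def B_def)
    then show "K \<in> {K. set K \<subseteq> {..<k} \<and> length K \<le> Suc k}"
      using wf_entry_run[OF en(3)] cap_settled[OF en(2)] L_le by (auto simp: wf_entry_def)
  qed
  ultimately have "finite B'"
    using finite_lists_length_le[of "{..<k}" "Suc k"] finite_subset finite_imageD by blast
  moreover have "B \<subseteq> B' \<union> set (ents (run T))"
  proof
    fix en assume "en \<in> B"
    then obtain t where t: "T \<le> t" "en \<in> set (ents (run t))" "L \<le> lev en" by (auto simp: B_def)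
    have 1: "lv u \<le> L \<and> lv u \<le> 2 * cap (run u)" if "T \<le> u" for u
      using lv_settled[OF that] cap_settled[OF that] L_le by simp
    show "en \<in> B' \<union> set (ents (run T))"
    proof (cases "lev en = L")
      case True
      then show ?thesis using \<open>en \<in> B\<close> by (simp add: B'_def)
    next
      case False
      then show ?thesis using entry_not_new[of T t en L] 1 t by auto
    qed
  qed
  ultimately have "finite B" using finite_subset by blast
  moreover have "- Q \<subseteq> val ` B"
  proof
    fix y assume y: "y \<in> - Q"
    show "y \<in> val ` B"
    proof (rule ccontr)
      assume nb: "y \<notin> val ` B"
      obtain n where n: "\<forall>t\<ge>n. y < bnd (run t)" using bnd_unbounded[OF events_unbounded[OF L(2)]] by blast
      obtain t ev where t: "n \<le> t" "T \<le> t" "fires t ev" "lev ev = L" using obtain_event[OF L(2)] by metis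
      have "inQ (run (Suc t)) y"
      proof (rule inQ_after_event[OF t(3)])
        show "y < bnd (run t)" using n t by blast
        fix en assume "en \<in> set (ents (run (Suc t)))" "lev ev \<le> lev en"
        then have "en \<in> B" unfolding B_def using t by (metis (mono_tags, lifting) le_SucI mem_Collect_eq)
        then show "val en \<noteq> y" using nb by blast
      qed
      then show False using y by (auto simp: Q_def)
    qed
  qed
  ultimately show ?thesis by (meson finite_imageI finite_subset)
qed

end


section \<open>Correctness of the vacillating learner\<close>

context diag
begin

text \<open>The test of the vacillating learner: an active marker among the data speaks for the
  index of \<open>Q\<close>, its absence for that of the column.\<close>

definition zhit :: "nat \<Rightarrow> nat set \<Rightarrow> bool" where
  "zhit t F \<longleftrightarrow> (\<exists>en\<in>set (ents (run t)). key en = [] \<and> val en \<in> F)"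

lemma zhit_if_zvals: "y \<in> zvals (run t) l \<Longrightarrow> y \<in> F \<Longrightarrow> zhit t F"
  unfolding zvals_def zhit_def by blast

lemma idle_run: "t0 \<le> t \<Longrightarrow> (\<And>u. t0 \<le> u \<Longrightarrow> u < t \<Longrightarrow> lv u = 0) \<Longrightarrow> run t = run t0"
  by (induction rule: dec_induct) (auto simp: lv_0)

lemma search_forever:
  assumes "\<And>u. t0 \<le> u \<Longrightarrow> lv u = 0"
  shows "A t0 0 = - vals (run t0)" "Q \<inter> vals (run t0) = {}"
proof -
  have run: "run t = run t0" if "t0 \<le> t" for t using idle_run[of t0 t] assms that by simp
  have al: "alive t0 0 t" for t using assms by (auto simp: alive_def)
  show q: "Q \<inter> vals (run t0) = {}"
  proof -
    have False if "inQ (run t) y" "y \<in> vals (run t0)" for t y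
      using inQ_mono[OF max.cobounded1 that(1), of t0] run[of "max t t0"] that(2) by (simp add: inQ_def)
    then show ?thesis by (auto simp: Q_def)
  qed
  show "A t0 0 = - vals (run t0)"
  proof (rule set_eqI)
    fix y
    have "y \<in> A t0 0" if "y \<notin> vals (run t0)"
      unfolding A_def using that al run[of "max t0 (Suc y)"]
      by (auto simp: member_def intro!: exI[of _ "max t0 (Suc y)"])
    moreover have "y \<notin> vals (run t0)" if y: "y \<in> A t0 0"
    proof -
      obtain t where t: "t \<ge> t0" "member t0 0 t y" using y by (auto simp: A_def)
      then show ?thesis using al run[OF t(1)] by (auto simp: member_def inQ_def)
    qed
    ultimately show "y \<in> A t0 0 \<longleftrightarrow> y \<in> - vals (run t0)" by blast
  qed
qed

text \<open>A search alive forever keeps the markers of level \<open>2 * j - 1\<close>; it forces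
  \<open>L \<le> 2 * j\<close>, and the parity of \<open>L\<close> improves this by one. A search
  that has ended follows the top level \<open>2 * k - 1\<close>. In both cases the level is at least
  \<open>L\<close>, so its markers are final.\<close>

lemma (in settled) member_settled:
  assumes L: "odd L \<or> L = 0" and nj: "\<not> (j = 0 \<and> (\<forall>t. alive t0 j t))"
  shows "\<exists>T' c. T \<le> T' \<and> t0 \<le> T' \<and> odd c \<and> L \<le> c \<and> c \<le> 2 * k \<and>
    (\<forall>t\<ge>T'. \<forall>y. member t0 j t y \<longleftrightarrow> inQ (run t) y \<or> y \<in> zvals (run T) c)"
proof (cases "\<forall>t. alive t0 j t")
  case True
  then have j: "0 < j" "j \<le> cap (run t0)" using nj by (auto simp: alive_def)
  then have "j \<le> k" using cap_mono[of t0 "max t0 T"] cap_settled[of "max t0 T"] by simp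
  obtain t where t: "t \<ge> t0" "lv t = L" using lv_recurs by blast
  have "L \<le> 2 * j" using True[rule_format, of "Suc t"] t by (auto simp: alive_def)
  then have "L \<le> 2 * j - 1" using L j by (cases "L = 2 * j") auto
  then have z: "zvals (run t) (2 * j - 1) = zvals (run T) (2 * j - 1)" if "t \<ge> max t0 T" for t
    using zvals_settled[of t] that by simp
  have "\<forall>t\<ge>max t0 T. \<forall>y. member t0 j t y \<longleftrightarrow> inQ (run t) y \<or> y \<in> zvals (run T) (2 * j - 1)"
    unfolding member_def using True j(1) z by (metis not_less_zero)
  moreover have "odd (2 * j - 1)" "2 * j - 1 \<le> 2 * k" using j \<open>j \<le> k\<close> by auto
  ultimately show ?thesis using \<open>L \<le> 2 * j - 1\<close> by (meson max.cobounded1 max.cobounded2)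
next
  case False
  then obtain t1 where "\<not> alive t0 j t1" by blast
  then have dead: "\<not> alive t0 j t" if "t1 \<le> t" for t
    using that unfolding alive_def by (meson less_le_trans)
  have "L \<le> 2 * k - 1" using L L_le k_pos by (cases "L = 2 * k") auto
  then have z: "zvals (run t) (2 * cap (run t) - 1) = zvals (run T) (2 * k - 1)" if "t \<ge> max t1 (max t0 T)" for t
    using zvals_settled[of t] cap_settled[of t] that by simp
  have "\<forall>t\<ge>max t1 (max t0 T). \<forall>y. member t0 j t y \<longleftrightarrow> inQ (run t) y \<or> y \<in> zvals (run T) (2 * k - 1)"
    unfolding member_def using dead z by (metis max.bounded_iff)
  moreover have "odd (2 * k - 1)" "2 * k - 1 \<le> 2 * k" using k_pos by auto
  moreover have "T \<le> max t1 (max t0 T)" "t0 \<le> max t1 (max t0 T)" by auto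
  ultimately show ?thesis using \<open>L \<le> 2 * k - 1\<close> by blast
qed

text \<open>The disjuncts are the ways to succeed: both indices are right, or the index of
  \<open>Q\<close> is and is finally chosen, or that of the column. If \<open>Q\<close> is
  coinfinite, then either a final marker appears in the data, or the search for \<open>j = 0\<close>
  runs forever and no marker belongs to the target.\<close>

lemma vacillation:
  assumes f: "range f = A t0 j"
  shows "finite (- A t0 j) \<and> finite (- Q) \<or>
    (\<exists>n0. \<forall>n\<ge>n0. zhit n (f ` {..<n})) \<and> finite (A t0 j - Q) \<or>
    (\<exists>n0. \<forall>n\<ge>n0. \<not> zhit n (f ` {..<n})) \<and> finite (- A t0 j)"
proof (cases "finite (- Q)")
  case True
  then have "finite (- A t0 j)" using Q_subset_A by (meson Compl_subset_Compl_iff finite_subset)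
  then show ?thesis using True by blast
next
  case False
  then have "\<not> unsettled" using unsettled_Q by auto
  then obtain T k L where "settled h e T k L" using settledI by blast
  then interpret settled h e T k L .
  have L: "odd L \<or> L = 0" using even_cofinite False by blast
  show ?thesis
  proof (cases "j = 0 \<and> (\<forall>t. alive t0 j t)")
    case True
    have idle: "lv u = 0" if "t0 \<le> u" for u
      using True that unfolding alive_def by (metis le_zero_eq lessI mult_0_right)
    have run: "run t = run t0" if "t0 \<le> t" for t using idle_run[of t0 t] idle that by simp
    have A: "A t0 j = - vals (run t0)" using search_forever(1)[OF idle] True by simp
    have "\<not> zhit n (f ` {..<n})" if "n \<ge> t0" for n
    proof
      assume "zhit n (f ` {..<n})"
      then obtain en where "en \<in> set (ents (run n))" "val en \<in> f ` {..<n}" by (auto simp: zhit_def)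
      then have "val en \<in> vals (run t0)" "val en \<in> A t0 j" using run[OF that] f val_in_vals by fastforce+
      then show False using A by blast
    qed
    moreover have "finite (- A t0 j)" using A finite_vals by simp
    ultimately show ?thesis by blast
  next
    case nj: False
    obtain T' c where c: "T \<le> T'" "t0 \<le> T'" "odd c" "c \<le> 2 * k" "L \<le> c"
      "\<forall>t\<ge>T'. \<forall>y. member t0 j t y \<longleftrightarrow> inQ (run t) y \<or> y \<in> zvals (run T) c"
      using member_settled[OF L nj] by blast
    obtain z where z: "z \<in> zvals (run T) c" using zvals_nonempty[OF c(3,4)] by blast
    then have mz: "member t0 j t z" if "T' \<le> t" for t using c that by blast
    then have "z \<in> A t0 j" unfolding A_def using c by blast
    then obtain i where i: "f i = z" using f by (metis rangeE)
    have "zhit n (f ` {..<n})" if n: "n \<ge> max T' (Suc i)" for n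
    proof -
      have "z \<in> zvals (run n) c" using zvals_settled[of n c] c n z by simp
      then show ?thesis using zhit_if_zvals i n by (metis (no_types, lifting) image_eqI lessThan_iff max.bounded_iff Suc_le_eq)
    qed
    \<comment> \<open>A number outside \<open>Q\<close> can join the target only before
      \<open>T'\<close>, where finitely many do, or as a final marker.\<close>
    moreover have "A t0 j - Q \<subseteq> (\<Union>t\<in>{..<T'}. {y. member t0 j t y}) \<union> zvals (run T) c"
    proof
      fix y assume "y \<in> A t0 j - Q"
      then obtain t where "member t0 j t y" "\<not> inQ (run t) y" by (auto simp: A_def Q_def)
      then show "y \<in> (\<Union>t\<in>{..<T'}. {y. member t0 j t y}) \<union> zvals (run T) c" using c
        by (cases "t < T'") auto
    qed
    then have "finite (A t0 j - Q)"
      by (rule finite_subset) (use finite_member finite_subset[OF zvals_subset finite_vals] in auto)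
    ultimately show ?thesis by blast
  qed
qed

end

section \<open>Failure of learners whose final hypotheses agree\<close>

lemma map_upt_prefix:
  assumes "prefix s (map f [0..<n])"
  shows "s = map f [0..<length s]"
proof -
  have "s = take (length s) (map f [0..<n])" and "length s \<le> n"
    using assms prefix_length_le[OF assms] by (auto simp: prefix_def)
  then show ?thesis by (simp add: take_map min_def)
qed

lemma prefix_nth: "prefix xs ys \<Longrightarrow> n < length xs \<Longrightarrow> xs ! n = ys ! n"
  by (auto simp: prefix_def nth_append)

locale learned = diag +
  fixes M :: "nat list \<Rightarrow> nat"
  assumes guess_iff: "(\<exists>t. guess t s a) \<longleftrightarrow> a = M s"
begin

definition w :: "nat \<Rightarrow> nat set" where
  "w a = {x. \<exists>t. enum t a x}"

text \<open>TxtFext-identification with both bounds infinite, restricted to column \<open>e\<close>: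
  hypotheses are judged only by their part \<open>w a\<close> in this column.\<close>

definition learns :: "nat set \<Rightarrow> bool" where
  "learns B \<longleftrightarrow> (\<forall>f. range f = B \<longrightarrow>
     (\<exists>S n0. finite S \<and> (\<forall>n\<ge>n0. M (map f [0..<n]) \<in> S) \<and>
        (\<forall>a\<in>S. \<forall>b\<in>S. w a = w b) \<and> (\<forall>a\<in>S. finite (w a - B) \<and> finite (B - w a))))"

lemma guess_eventually: "\<exists>n. \<forall>t\<ge>n. guess t s (M s)"
  using guess_iff[of s "M s"] guess_mono by blast

lemma guessD: "guess t s a \<Longrightarrow> a = M s"
  using guess_iff by blast

lemma enum_eventually: "x \<in> w a \<Longrightarrow> \<exists>n. \<forall>t\<ge>n. enum t a x"
  unfolding w_def using enum_mono by blast

text \<open>\<open>s\<close> followed by an enumeration of \<open>B\<close> is a text for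
  \<open>B\<close>, so far enough along it the hypothesis is one of the final ones.\<close>

lemma learns_extension:
  assumes B: "learns B" "B \<noteq> {}" and s: "set s \<subseteq> B"
  shows "\<exists>r. set r \<subseteq> B \<and> finite (w (M (s @ r)) - B) \<and> finite (B - w (M (s @ r)))"
proof -
  obtain g :: "nat \<Rightarrow> nat" where g: "range g = B"
    using range_from_nat_into[of B] B(2) by blast
  define f where "f n = (if n < length s then s ! n else g (n - length s))" for n
  have "range f = B"
  proof
    show "range f \<subseteq> B" using s g by (auto simp: f_def)
    show "B \<subseteq> range f"
    proof
      fix y assume "y \<in> B"
      then obtain i where "y = g i" using g by blast
      then have "f (i + length s) = y" by (simp add: f_def)
      then show "y \<in> range f" by (metis rangeI)
    qed
  qed
  then obtain S n0 where S: "\<forall>n\<ge>n0. M (map f [0..<n]) \<in> S" "\<forall>a\<in>S. finite (w a - B) \<and> finite (B - w a)"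
    using B(1) unfolding learns_def by metis
  have "map f [0..<length s + n0] = s @ map g [0..<n0]"
    by (rule nth_equalityI) (auto simp: f_def nth_append)
  then have "M (s @ map g [0..<n0]) \<in> S" using S(1) by (metis le_add2)
  then show ?thesis using S(2) g by (intro exI[of _ "map g [0..<n0]"]) auto
qed

text \<open>An event that stays possible does happen, because its description recurs.\<close>

lemma eventually_fires:
  assumes "\<forall>t\<ge>n. trigger t (run t) d"
  shows "\<exists>t\<ge>n. lv t = lev (event (run t) d)"
proof -
  obtain t where "t \<ge> n" "descr t = d" using descr_recurs by blast
  then show ?thesis using assms by (auto simp: lv_def)
qed

section \<open>Texts assembled along the run\<close>

definition outs :: "nat list \<Rightarrow> nat list \<Rightarrow> nat set" where
  "outs s s' = {M r | r. prefix s r \<and> prefix r s'}"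

lemma outs_mono: "prefix s' s'' \<Longrightarrow> outs s s' \<subseteq> outs s s''"
  unfolding outs_def using prefix_order.trans by blast

text \<open>An event builds either on the current text or on an entry of lower level, and each
  hypothesis it adds is the output on the text it records.\<close>

lemma base_event:
  assumes p: "prefix s (stxt (run t))"
    and en: "\<And>en. en \<in> set (ents (run t)) \<Longrightarrow> lev en < L \<Longrightarrow> key en \<noteq> [] \<Longrightarrow>
      prefix s (etxt en) \<and> set (key en) \<subseteq> outs s (etxt en)"
    and ev: "fires t ev" "lev ev \<le> L"
  shows "prefix s (etxt ev) \<and> set (key ev) \<subseteq> outs s (etxt ev)"
  using ev(1)
proof (cases rule: fires_cases)
  case (search x r a)
  have "prefix s (stxt (run t) @ r)" using p by simp
  moreover from this have "M (stxt (run t) @ r) \<in> outs s (stxt (run t) @ r)" by (auto simp: outs_def)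
  ultimately show ?thesis using search guessD[OF search(5)] by auto
next
  case (branch en r a)
  have "lev en < L"
    using branch(1,7) ev(2) wf_entry_run[OF branch(1)] by (auto simp: wf_entry_def split: if_splits)
  then have e: "prefix s (etxt en)" "set (key en) \<subseteq> outs s (etxt en)" using en branch by auto
  then have "prefix s (etxt en @ r)" by simp
  moreover from this have "M (etxt en @ r) \<in> outs s (etxt en @ r)" by (auto simp: outs_def)
  moreover have "set (key en) \<subseteq> outs s (etxt en @ r)" using e(2) outs_mono[of "etxt en" "etxt en @ r" s] by auto
  ultimately show ?thesis using branch guessD[OF branch(5)] by auto
next
  case (close en a K)
  then show ?thesis using en[of en] ev(2) by auto
qed

text \<open>The hypothesis \<open>base\<close> says that below \<open>L\<close> only markers are
  left, as happens after an event of level \<open>L\<close> or a raise of the cap. All lists found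
  there later stem from extensions of the text at \<open>t0\<close>.\<close>

lemma base_inv:
  assumes "t0 \<le> t" and base: "\<And>en. en \<in> set (ents (run t0)) \<Longrightarrow> lev en < L \<Longrightarrow> key en = []"
    and "\<And>u. t0 \<le> u \<Longrightarrow> u < t \<Longrightarrow> lv u \<le> L"
  shows "prefix (stxt (run t0)) (stxt (run t)) \<and>
    (\<forall>en\<in>set (ents (run t)). lev en < L \<longrightarrow> key en \<noteq> [] \<longrightarrow>
       prefix (stxt (run t0)) (etxt en) \<and> set (key en) \<subseteq> outs (stxt (run t0)) (etxt en))"
  using assms(1,3)
proof (induction rule: dec_induct)
  case base
  then show ?case using assms(2) by auto
next
  case (step n)
  let ?s = "stxt (run t0)"
  have IH: "prefix ?s (stxt (run n))"
    "\<And>en. en \<in> set (ents (run n)) \<Longrightarrow> lev en < L \<Longrightarrow> key en \<noteq> [] \<Longrightarrow>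
      prefix ?s (etxt en) \<and> set (key en) \<subseteq> outs ?s (etxt en)"
    using step by auto
  show ?case
  proof (cases n rule: step_cases)
    case idle
    then show ?thesis using IH by auto
  next
    case (event ev)
    have "lev ev \<le> L" using event(2) step.prems[of n] step.hyps by simp
    from base_event[OF IH event(1) this]
    have e: "prefix ?s (etxt ev)" "set (key ev) \<subseteq> outs ?s (etxt ev)" by auto
    have "prefix ?s (stxt (run (Suc n)))" using e(1) unfolding event(3) by (simp add: apply_event_def)
    moreover have "prefix ?s (etxt en) \<and> set (key en) \<subseteq> outs ?s (etxt en)"
      if "en \<in> set (ents (run (Suc n)))" "lev en < L" "key en \<noteq> []" for en
      using that(1)[unfolded event(3)]
    proof (cases rule: in_ents_apply_event)
      case (zero i)
      then show ?thesis using that by simp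
    next
      case new
      then show ?thesis using e by simp
    next
      case old
      then show ?thesis using IH(2) that by blast
    qed
    ultimately show ?thesis by blast
  qed
qed

text \<open>The texts after the events in \<open>G\<close> form a chain under \<open>prefix\<close>.
  They stay inside \<open>Q\<close> and each lists all of \<open>Q\<close> enumerated so far, so
  their limit is a text for \<open>Q\<close>; infinity of \<open>Q\<close> makes the lengths
  unbounded.\<close>

lemma limit_text:
  assumes G: "\<And>n. \<exists>t\<ge>n. G t" "\<And>t. G t \<Longrightarrow> 0 < lv t"
    and pre: "\<And>t t'. G t \<Longrightarrow> Suc t \<le> t' \<Longrightarrow> prefix (stxt (run (Suc t))) (stxt (run t'))"
    and inf: "infinite Q"
  shows "\<exists>f. range f = Q \<and> (\<forall>t. G t \<longrightarrow> stxt (run (Suc t)) = map f [0..<length (stxt (run (Suc t)))]) \<and>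
    (\<forall>n. \<exists>t\<ge>n. G t \<and> n \<le> length (stxt (run (Suc t))))"
proof -
  have sub: "set (stxt (run t)) \<subseteq> Q" for t
    using wf_run[of t] by (auto simp: wf_state_def Q_def)
  have full: "{y. inQ (run (Suc t)) y} \<subseteq> set (stxt (run (Suc t)))" if Gt: "G t" for t
  proof -
    obtain ev where "fires t ev" using lv_pos G(2)[OF Gt] by blast
    from fires_step[OF this] show ?thesis by (simp add: stxt_apply_event)
  qed
  have long: "\<exists>t\<ge>n. G t \<and> n \<le> length (stxt (run (Suc t)))" for n
  proof -
    obtain F where F: "finite F" "card F = n" "F \<subseteq> Q" using inf infinite_arbitrarily_large by blast
    then obtain m where m: "\<forall>t\<ge>m. \<forall>y\<in>F. inQ (run t) y" using Q_at by blast
    obtain t where t: "t \<ge> max n m" "G t" using G(1) by blast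
    have "F \<subseteq> set (stxt (run (Suc t)))" using m t full[OF t(2)] by auto
    then have "card F \<le> card (set (stxt (run (Suc t))))" by (simp add: card_mono)
    also have "\<dots> \<le> length (stxt (run (Suc t)))" by (rule card_length)
    finally show ?thesis using t F by auto
  qed
  \<comment> \<open>A time in \<open>G\<close> whose next text has a position \<open>n\<close>; by
    \<open>nth\<close> below, every other such time gives the same value there.\<close>
  define c where "c n = (SOME t. G t \<and> Suc n \<le> length (stxt (run (Suc t))))" for n
  have "G (c n) \<and> Suc n \<le> length (stxt (run (Suc (c n))))" for n
  proof -
    have "\<exists>t. G t \<and> Suc n \<le> length (stxt (run (Suc t)))" using long[of "Suc n"] by blast
    from someI_ex[OF this] show ?thesis unfolding c_def .
  qed
  then have c: "G (c n)" "n < length (stxt (run (Suc (c n))))" for n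
    by (simp_all add: Suc_le_eq)
  define f where "f n = stxt (run (Suc (c n))) ! n" for n
  have nth: "stxt (run (Suc t)) ! n = f n" if t: "G t" "n < length (stxt (run (Suc t)))" for t n
  proof -
    let ?m = "max (Suc t) (Suc (c n))"
    have "prefix (stxt (run (Suc t))) (stxt (run ?m))" "prefix (stxt (run (Suc (c n)))) (stxt (run ?m))"
      using pre[OF t(1)] pre[OF c(1)] by auto
    then show ?thesis unfolding f_def using prefix_nth t(2) c(2)[of n] by metis
  qed
  have eq: "stxt (run (Suc t)) = map f [0..<length (stxt (run (Suc t)))]" if "G t" for t
    by (rule nth_equalityI) (simp_all add: nth[OF that])
  have "range f = Q"
  proof
    show "range f \<subseteq> Q" unfolding f_def using c(2) sub nth_mem by blast
    show "Q \<subseteq> range f"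
    proof
      fix y assume "y \<in> Q"
      then obtain m where "inQ (run m) y" by (auto simp: Q_def)
      moreover obtain t where t: "t \<ge> m" "G t" using G(1) by blast
      ultimately have "inQ (run (Suc t)) y" using inQ_mono[of m "Suc t"] by simp
      then have "y \<in> set (stxt (run (Suc t)))" using full[OF t(2)] by blast
      moreover have "set (stxt (run (Suc t))) \<subseteq> range f" by (subst eq[OF t(2)]) auto
      ultimately show "y \<in> range f" by blast
    qed
  qed
  then show ?thesis using eq long by blast
qed

text \<open>The text of the event is a prefix of the text that follows it, hence of
  \<open>f\<close>; outputs beyond \<open>s\<close> thus occur on initial segments of
  \<open>f\<close> of length at least \<open>n0\<close>.\<close>

lemma late_outs:
  assumes f: "\<And>t. G t \<Longrightarrow> stxt (run (Suc t)) = map f [0..<length (stxt (run (Suc t)))]"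
    and S: "\<forall>n\<ge>n0. M (map f [0..<n]) \<in> S"
    and t: "n0 \<le> length s" and t': "G t'" "fires t' ev" and p: "prefix s (etxt ev)"
  shows "outs s (etxt ev) \<subseteq> S" "M (etxt ev) \<in> S"
proof -
  show 1: "outs s (etxt ev) \<subseteq> S"
  proof
    fix b assume "b \<in> outs s (etxt ev)"
    then obtain r where r: "b = M r" "prefix s r" "prefix r (etxt ev)" by (auto simp: outs_def)
    have "prefix (etxt ev) (stxt (run (Suc t')))" unfolding fires_step[OF t'(2)] by (simp add: apply_event_def)
    then have "prefix r (stxt (run (Suc t')))" using r(3) by (rule prefix_order.trans[rotated])
    then have "prefix r (map f [0..<length (stxt (run (Suc t')))])" by (subst f[OF t'(1), symmetric])
    then have "r = map f [0..<length r]" by (rule map_upt_prefix)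
    moreover have "n0 \<le> length r" using prefix_length_le[OF r(2)] t by simp
    ultimately show "b \<in> S" using S r(1) by metis
  qed
  show "M (etxt ev) \<in> S" using 1 p by (auto simp: outs_def)
qed

text \<open>\<open>Q = UNIV\<close> is then itself a target. On one text for it, each raise of the
  cap exhibits a hypothesis at least as large as the cap, and the caps are unbounded, so no finite
  set of hypotheses suffices.\<close>

lemma not_unsettled:
  assumes learns: "\<And>t j. learns (A t j)" and un: "unsettled"
  shows False
proof -
  define G where "G t \<longleftrightarrow> 2 * cap (run t) < lv t" for t
  have G: "\<exists>t\<ge>n. G t" for n using un unfolding unsettled_def G_def by blast
  have Q: "Q = UNIV" by (rule unsettled_Q[OF un])
  then have AQ: "A 0 0 = Q" using Q_subset_A by blast
  have inv: "prefix (stxt (run (Suc t))) (stxt (run t')) \<and>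
    (\<forall>ev. fires t' ev \<longrightarrow> prefix (stxt (run (Suc t))) (etxt ev))" if Gt: "G t" and tt: "Suc t \<le> t'" for t t'
  proof -
    \<comment> \<open>No event up to \<open>t'\<close> exceeds \<open>B\<close>, and raising the cap
      has left only markers on all levels, so \<open>base_inv\<close> applies with \<open>B\<close>
      in place of \<open>L\<close>.\<close>
    define B where "B = Max (lv ` {..t'})"
    have B: "lv u \<le> B" if "u \<le> t'" for u unfolding B_def using that by simp
    obtain ev where ev: "fires t ev" using lv_pos[of t] Gt by (auto simp: G_def)
    have b: "key en = []" if "en \<in> set (ents (run (Suc t)))" for en
      using that[unfolded fires_step[OF ev]]
    proof (cases rule: in_ents_apply_event)
      case (zero i)
      then show ?thesis by simp
    next
      case new
      then show ?thesis using \<open>G t\<close> fires_lv[OF ev] by (simp add: G_def)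
    next
      case old
      then show ?thesis using \<open>G t\<close> fires_lv[OF ev] wf_entry_run[OF old(1)] by (simp add: G_def wf_entry_def)
    qed
    note inv = base_inv[OF tt, of B, OF b B[OF less_imp_le]]
    have "prefix (stxt (run (Suc t))) (etxt ev') \<and> set (key ev') \<subseteq> outs (stxt (run (Suc t))) (etxt ev')"
      if ev': "fires t' ev'" for ev'
    proof -
      have le: "lev ev' \<le> B" using fires_lv[OF ev'] B[of t'] by simp
      show ?thesis by (rule base_event[OF _ _ ev' le]) (use inv in blast)+
    qed
    then show ?thesis using inv by blast
  qed
  have pos: "0 < lv t" if "G t" for t using that by (simp add: G_def)
  have pre: "prefix (stxt (run (Suc t))) (stxt (run t'))" if "G t" "Suc t \<le> t'" for t t'
    using inv[OF that] by blast
  have inf: "infinite Q" using Q by simp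
  obtain f where f: "range f = Q"
    "\<And>t. G t \<Longrightarrow> stxt (run (Suc t)) = map f [0..<length (stxt (run (Suc t)))]"
    "\<And>n. \<exists>t\<ge>n. G t \<and> n \<le> length (stxt (run (Suc t)))"
    using limit_text[OF G pos pre inf] by blast
  obtain S n0 where S: "finite S" "\<forall>n\<ge>n0. M (map f [0..<n]) \<in> S"
    using learns[of 0 0] f(1) unfolding learns_def AQ by metis
  obtain t1 where t1: "G t1" "n0 \<le> length (stxt (run (Suc t1)))" using f(3) by blast
  obtain m where m: "\<forall>t\<ge>m. Max (insert 0 S) < cap (run t)"
    using cap_unbounded[of "Max (insert 0 S)"] G unfolding G_def by blast
  obtain t2 where t2: "t2 \<ge> max m (Suc t1)" "G t2" using G by blast
  obtain ev where ev: "fires t2 ev" using lv_pos[of t2] t2(2) by (auto simp: G_def)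
  obtain a where a: "cap (run t2) \<le> a" "guess t2 (etxt ev) a"
    using super_event[OF ev] fires_lv[OF ev] t2(2) by (auto simp: G_def)
  have "Suc t1 \<le> t2" using t2(1) by simp
  then have "prefix (stxt (run (Suc t1))) (etxt ev)" using inv[OF t1(1)] ev by blast
  with late_outs(2)[of G f n0 S "stxt (run (Suc t1))" t2 ev] f(2) S(2) t1(2) t2(2) ev
  have "M (etxt ev) \<in> S" by blast
  then have "a \<le> Max (insert 0 S)" using guessD[OF a(2)] S(1) by simp
  then show False using a(1) m t2(1) by (metis max.bounded_iff linorder_not_le le_trans)
qed

end

section \<open>Refuting the three settled outcomes\<close>

locale settled_learned = settled h e T k L + learned h e M for h e T k L M +
  assumes learns: "learns (A t j)"
begin

text \<open>If events stopped, the target would be cofinite and so would a suitable hypothesis. It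
  would contain a new witness, and a search event would follow.\<close>

lemma not_zero: "L \<noteq> 0"
proof
  assume L: "L = 0"
  then have idle: "lv u = 0" if "T \<le> u" for u using lv_settled[OF that] by simp
  then have run: "run t = run T" if "T \<le> t" for t using idle_run[of T t] that by simp
  have A: "A T 0 = - vals (run T)" by (rule search_forever(1)[OF idle])
  have "set (stxt (run T)) \<subseteq> Q" using wf_run[of T] by (auto simp: wf_state_def Q_def)
  then have s: "set (stxt (run T)) \<subseteq> A T 0" using Q_subset_A by blast
  have ne: "A T 0 \<noteq> {}" using A finite_vals[of "run T"] by (metis Compl_empty_eq double_compl infinite_UNIV_nat)
  obtain r where r: "set r \<subseteq> A T 0" "finite (A T 0 - w (M (stxt (run T) @ r)))"
    using learns_extension[OF learns ne s] by blast
  define a where "a = M (stxt (run T) @ r)"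
  have "- w a \<subseteq> (A T 0 - w a) \<union> vals (run T)" using A by blast
  then have "finite (- w a)" using r(2) finite_vals unfolding a_def by (meson finite_UnI finite_subset)
  then have "finite (- w a \<union> {..<bnd (run T)} \<union> vals (run T) \<union> set r)" using finite_vals by simp
  from ex_new_if_finite[OF infinite_UNIV_nat this]
  obtain x where x: "x \<notin> - w a \<union> {..<bnd (run T)} \<union> vals (run T) \<union> set r" by (rule exE)
  obtain n1 where n1: "\<forall>t\<ge>n1. guess t (stxt (run T) @ r) a" using guess_eventually unfolding a_def by blast
  obtain n2 where n2: "\<forall>t\<ge>n2. enum t a x" using enum_eventually[of x a] x by blast
  \<comment> \<open>The entry in this description is a dummy that carries the witness
    \<open>x\<close> as its value.\<close>
  have "\<forall>t\<ge>max T (max n1 n2). trigger t (run t) (0, (0, [], x, []), r, a)"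
  proof (intro allI impI)
    fix t assume t: "t \<ge> max T (max n1 n2)"
    have "run t = run T" by (rule run) (use t in simp)
    then show "trigger t (run t) (0, (0, [], x, []), r, a)"
      using n1 n2 t x r(1)[unfolded A] unfolding trigger_def by (simp add: vals_def) blast
  qed
  from eventually_fires[OF this] obtain t where "t \<ge> T" "lv t = lev (event (run t) (0, (0, [], x, []), r, a))"
    by auto
  then show False using idle lev_event_pos by (metis less_irrefl)
qed

text \<open>Each witness on level \<open>L\<close> lies in some \<open>w b\<close> with
  \<open>b < k\<close> and \<open>w b\<close> almost contained in the target, since otherwise an
  event of a higher level would occur. As witnesses lie outside the target, there are only finitely
  many; yet every event of level \<open>L\<close> brings one not yet present on that level.\<close>

lemma not_odd: "even L"
proof (rule ccontr)
  assume L: "odd L"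
  define j where "j = Suc (L div 2)"
  have j: "L = 2 * j - 1" "0 < j" "j \<le> k" using L L_le by (auto simp: j_def elim!: oddE)
  define Z where "Z = zvals (run T) L"
  have Z: "zvals (run t) L = Z" if "T \<le> t" for t unfolding Z_def by (rule zvals_settled[OF that order_refl])
  have "lv u \<le> 2 * j" if "T \<le> u" for u using lv_settled[OF that] j by simp
  then have al: "alive T j t" for t using j cap_settled[of T] unfolding alive_def by simp
  have mem: "member T j t y \<longleftrightarrow> inQ (run t) y \<or> y \<in> Z" if "T \<le> t" for t y
    using al[of t] j Z[OF that] by (simp add: member_def)
  have A: "A T j = Q \<union> Z"
  proof
    show "A T j \<subseteq> Q \<union> Z" using mem by (auto simp: A_def Q_def)
    show "Q \<union> Z \<subseteq> A T j" using Q_subset_A[of T j] mem[of T] by (auto simp: A_def)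
  qed
  have ne: "A T j \<noteq> {}" using A zvals_nonempty[OF L L_le] unfolding Z_def by blast
  define X where "X = {val en | en. \<exists>t\<ge>T. en \<in> set (ents (run t)) \<and> lev en = L \<and> key en \<noteq> []}"
  have XA: "x \<notin> A T j" if xX: "x \<in> X" for x
  proof
    assume "x \<in> A T j"
    obtain en t where en: "x = val en" "T \<le> t" "en \<in> set (ents (run t))" "lev en = L" "key en \<noteq> []"
      using xX unfolding X_def by blast
    have "x \<in> Q \<union> Z" using A \<open>x \<in> A T j\<close> by simp
    then show False
    proof
      assume "x \<in> Q"
      then obtain u where "inQ (run u) x" by (auto simp: Q_def)
      then have "inQ (run (max t u)) x" using inQ_mono[of u "max t u"] by simp
      moreover have "en \<in> set (ents (run (max t u)))" using persists[of t "max t u" en] en by simp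
      ultimately show False using en(1) val_in_vals by (auto simp: inQ_def)
    next
      assume "x \<in> Z"
      then have "x \<in> zvals (run t) L" using Z[OF en(2)] by simp
      then obtain en' where "en' \<in> set (ents (run t))" "key en' = []" "val en' = x"
        unfolding zvals_def by blast
      then show False using val_inj_run[of en' t en] en by simp
    qed
  qed
  have Xb: "\<exists>b<k. x \<in> w b \<and> finite (w b - A T j)" if xX: "x \<in> X" for x
  proof -
    obtain en t where en: "x = val en" "T \<le> t" "en \<in> set (ents (run t))" "lev en = L" "key en \<noteq> []"
      using xX unfolding X_def by blast
    have "set (etxt en) \<subseteq> Q" using wf_entry_run[OF en(3)] by (auto simp: wf_entry_def Q_def)
    then have "set (etxt en) \<subseteq> A T j" using Q_subset_A by blast
    then obtain r where r: "set r \<subseteq> A T j" "finite (w (M (etxt en @ r)) - A T j)"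
      using learns_extension[OF learns ne] by blast
    define b where "b = M (etxt en @ r)"
    obtain n1 where n1: "\<forall>t\<ge>n1. guess t (etxt en @ r) b" using guess_eventually unfolding b_def by blast
    \<comment> \<open>The part of \<open>r\<close> outside \<open>Z\<close> is enumerated into
      \<open>Q\<close> eventually, and \<open>Z\<close> consists of active markers of level
      \<open>L\<close>, so \<open>r\<close> becomes an admissible extension.\<close>
    obtain n2 where n2: "\<forall>t\<ge>n2. \<forall>y\<in>set r - Z. inQ (run t) y"
      using Q_at[of "set r - Z"] r(1) A by auto
    have "\<not> (k \<le> b \<or> x \<notin> w b)"
    proof
      assume kb: "k \<le> b \<or> x \<notin> w b"
      have "\<forall>u\<ge>max t (max n1 n2). trigger u (run u) (1, en, r, b)"
      proof (intro allI impI)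
        fix u assume u: "u \<ge> max t (max n1 n2)"
        have 1: "en \<in> set (ents (run u))" using persists[of t u en] en u by simp
        have 2: "inQ (run u) y \<or> y \<in> zvals (run u) L" if "y \<in> set r" for y
          using n2 u that Z[of u] en(2) by auto
        have 3: "cap (run u) \<le> b \<or> \<not> enum u b (val en)"
          using kb cap_settled[of u] en(1,2) u unfolding w_def by auto
        have 4: "(y < bnd (run u) \<and> \<not> (\<exists>en'\<in>set (ents (run u)). val en' = y)) \<or>
          (\<exists>en'\<in>set (ents (run u)). lev en' = lev en \<and> key en' = [] \<and> val en' = y)" if yr: "y \<in> set r" for y
          using 2[OF yr]
        proof
          assume "inQ (run u) y"
          then have "y < bnd (run u)" "y \<notin> val ` set (ents (run u))" by (auto simp: inQ_def vals_def)
          then show ?thesis by (metis imageI)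
        next
          assume "y \<in> zvals (run u) L"
          then obtain en' where "en' \<in> set (ents (run u))" "lev en' = lev en" "key en' = []" "val en' = y"
            unfolding zvals_def en(4) by blast
          then show ?thesis by blast
        qed
        show "trigger u (run u) (1, en, r, b)"
          unfolding trigger_def using 1 3 4 n1 u L en(4,5) by simp
      qed
      from eventually_fires[OF this] obtain u
        where u: "u \<ge> max t (max n1 n2)" "lv u = lev (event (run u) (1, en, r, b))" by auto
      then have "L < lv u" using cap_settled[of u] en(2,4) L_le by (auto simp: event_def)
      then show False using lv_settled[of u] u en(2) by simp
    qed
    then show ?thesis using r(2) unfolding b_def[symmetric] by (meson linorder_not_le)
  qed
  have "X \<subseteq> (\<Union>b\<in>{b. b < k \<and> finite (w b - A T j)}. w b - A T j)" using Xb XA by blast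
  moreover have "finite (\<Union>b\<in>{b. b < k \<and> finite (w b - A T j)}. w b - A T j)"
    by (rule finite_UN_I) simp_all
  ultimately have fin: "finite X" by (rule finite_subset)
  \<comment> \<open>Entries of level \<open>L\<close> persist, so finitely many witnesses are
    withheld together at some time. This is applied to \<open>X\<close>.\<close>
  have "\<exists>n\<ge>T. \<forall>x\<in>F. \<exists>en\<in>set (ents (run n)). lev en = L \<and> key en \<noteq> [] \<and> val en = x"
    if "finite F" "F \<subseteq> X" for F
    using that
  proof (induction rule: finite_induct)
    case (insert x F)
    then obtain n where n: "n \<ge> T" "\<forall>x\<in>F. \<exists>en\<in>set (ents (run n)). lev en = L \<and> key en \<noteq> [] \<and> val en = x" by auto
    obtain en t where en: "x = val en" "T \<le> t" "en \<in> set (ents (run t))" "lev en = L" "key en \<noteq> []"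
      using insert.prems unfolding X_def by blast
    have "\<forall>x\<in>insert x F. \<exists>en\<in>set (ents (run (max n t))). lev en = L \<and> key en \<noteq> [] \<and> val en = x"
      using n en persists[of t "max n t" en] persists[of n "max n t"] by (metis insert_iff max.cobounded1 max.cobounded2 order_refl)
    then show ?case using n(1) by (metis max.coboundedI1)
  qed auto
  from this[OF fin order_refl] obtain n where n: "n \<ge> T"
    "\<forall>x\<in>X. \<exists>en\<in>set (ents (run n)). lev en = L \<and> key en \<noteq> [] \<and> val en = x" by blast
  have "0 < L" using L by (rule odd_pos)
  then obtain t ev where t: "n \<le> t" "T \<le> t" "fires t ev" "lev ev = L" by (rule obtain_event)
  have g: "good_event t (run t) ev" by (rule good_event[OF t(3)])
  have "ev \<in> set (ents (run (Suc t)))"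
    unfolding fires_step[OF t(3)] ents_apply_event using t L L_le cap_settled[OF t(2)] by simp
  moreover have "T \<le> Suc t" "key ev \<noteq> []" using t(2) g by (simp_all add: good_event_def)
  ultimately have "val ev \<in> X" unfolding X_def using t(4) by blast
  then obtain en where en: "en \<in> set (ents (run n))" "lev en = L" "val en = val ev" using n by blast
  have ent: "en \<in> set (ents (run t))" using persists[of n t en] n t en by simp
  then have "val ev \<in> vals (run t)" using en(3) val_in_vals by metis
  then obtain en' where "en' \<in> set (ents (run t))" "val en' = val ev" "lev en' < L"
    using g t(4) unfolding good_event_def by auto
  then show False using val_inj_run[OF ent, of en'] en by auto
qed

text \<open>On level \<open>L = 2 * j\<close> the target is \<open>Q\<close> itself. Late on one
  text for \<open>Q\<close> all members of a list are output, so they agree; the second has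
  enumerated the witness, hence the head does too, and an event of level \<open>L + 1\<close>
  results.\<close>

lemma contradiction: False
proof -
  have L: "even L" "0 < L" using not_odd not_zero by auto
  define j where "j = L div 2"
  have j: "L = 2 * j" "0 < j" "j \<le> k" using L L_le by (auto simp: j_def)
  have zQ: "z \<in> Q" if t: "T \<le> t" "z \<in> zvals (run t) (2 * j - 1)" for t z
  proof -
    obtain en where en: "en \<in> set (ents (run t))" "lev en = 2 * j - 1" "key en = []" "val en = z"
      using t(2) unfolding zvals_def by blast
    \<comment> \<open>The first event of level \<open>L\<close> from \<open>t\<close> on: the marker
      persists until then and is released by this event.\<close>
    define u where "u = (LEAST u. t \<le> u \<and> lv u = L)"
    have u: "t \<le> u" "lv u = L" using LeastI_ex[of "\<lambda>u. t \<le> u \<and> lv u = L"] lv_recurs[of t] unfolding u_def by auto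
    have before: "lv v \<le> 2 * j - 1" if "t \<le> v" "v < u" for v
      using not_less_Least[of v "\<lambda>u. t \<le> u \<and> lv u = L"] that lv_settled[of v] t(1) j unfolding u_def by auto
    have enu: "en \<in> set (ents (run u))" by (rule entry_persists[OF u(1) en(1), of "2 * j - 1"]) (use en before in auto)
    obtain ev where ev: "fires u ev" using lv_pos[of u] u(2) L by auto
    have g: "good_event u (run u) ev" by (rule good_event[OF ev])
    have lev: "lev ev = 2 * j" using fires_lv[OF ev] u j by simp
    have "z < bnd (run u)" using wf_entry_run[OF enu] en(4) by (simp add: wf_entry_def)
    then have "inQ (apply_event (run u) ev) z"
    proof (intro inQ_apply_event[OF g])
      show "z < fresh (run u) ev" if "z < bnd (run u)" using that by (simp add: fresh_def)
      show "z \<noteq> val ev"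
      proof
        assume z: "z = val ev"
        then have "val ev \<in> vals (run u)" using enu en(4) val_in_vals by metis
        then obtain en' where "en' \<in> set (ents (run u))" "key en' \<noteq> []" "val en' = val ev"
          using g unfolding good_event_def by auto
        then show False using val_inj_run[OF enu, of en'] en z by auto
      qed
      show "\<forall>en'\<in>set (ents (run u)). lev ev \<le> lev en' \<longrightarrow> val en' \<noteq> z"
      proof (intro ballI impI notI)
        fix en' assume "en' \<in> set (ents (run u))" "lev ev \<le> lev en'" "val en' = z"
        then show False using val_inj_run[OF enu, of en'] en lev j by simp
      qed
    qed
    then show ?thesis using fires_step[OF ev] unfolding Q_def by (metis mem_Collect_eq)
  qed
  have al: "alive T j t" for t
    using j lv_settled cap_settled[of T] unfolding alive_def by auto
  have AQ: "A T j = Q"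
  proof
    show "A T j \<subseteq> Q" using al j zQ by (auto simp: A_def member_def Q_def)
  qed (rule Q_subset_A)
  define G where "G t \<longleftrightarrow> T \<le> t \<and> lv t = L" for t
  have G: "\<exists>t\<ge>n. G t" for n using lv_recurs[of "max n T"] unfolding G_def by auto
  have inv: "prefix (stxt (run (Suc t))) (stxt (run t')) \<and>
    (\<forall>ev. fires t' ev \<longrightarrow> prefix (stxt (run (Suc t))) (etxt ev) \<and>
      set (key ev) \<subseteq> outs (stxt (run (Suc t))) (etxt ev))" if Gt: "G t" and tt: "Suc t \<le> t'" for t t'
  proof -
    obtain ev where ev: "fires t ev" using lv_pos[of t] Gt L by (auto simp: G_def)
    have lv: "lv u \<le> L" if "Suc t \<le> u" for u using lv_settled[of u] that \<open>G t\<close> by (auto simp: G_def)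
    have b: "key en = []" if "en \<in> set (ents (run (Suc t)))" "lev en < L" for en
      using that(1)[unfolded fires_step[OF ev]]
    proof (cases rule: in_ents_apply_event)
      case (zero i)
      then show ?thesis by simp
    next
      case new
      then show ?thesis using \<open>G t\<close> fires_lv[OF ev] that(2) by (simp add: G_def)
    next
      case old
      then show ?thesis using \<open>G t\<close> fires_lv[OF ev] that(2) by (simp add: G_def)
    qed
    note inv = base_inv[OF tt, of L, OF b lv]
    have "prefix (stxt (run (Suc t))) (etxt ev') \<and> set (key ev') \<subseteq> outs (stxt (run (Suc t))) (etxt ev')"
      if ev': "fires t' ev'" for ev'
    proof -
      have le: "lev ev' \<le> L" using fires_lv[OF ev'] lv[OF tt] by simp
      show ?thesis by (rule base_event[OF _ _ ev' le]) (use inv in blast)+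
    qed
    then show ?thesis using inv by blast
  qed
  have inf: "infinite Q" using even_cofinite[OF L] by (metis Compl_empty_eq finite_compl infinite_UNIV_nat)
  have pos: "0 < lv t" if "G t" for t using that L by (simp add: G_def)
  have pre: "prefix (stxt (run (Suc t))) (stxt (run t'))" if "G t" "Suc t \<le> t'" for t t'
    using inv[OF that] by blast
  obtain f where f: "range f = Q"
    "\<And>t. G t \<Longrightarrow> stxt (run (Suc t)) = map f [0..<length (stxt (run (Suc t)))]"
    "\<And>n. \<exists>t\<ge>n. G t \<and> n \<le> length (stxt (run (Suc t)))"
    using limit_text[OF G pos pre inf] by blast
  obtain S n0 where S: "\<forall>n\<ge>n0. M (map f [0..<n]) \<in> S" "\<forall>a\<in>S. \<forall>b\<in>S. w a = w b"
    using learns[of T j] f(1) unfolding learns_def AQ by metis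
  obtain t1 where t1: "G t1" "n0 \<le> length (stxt (run (Suc t1)))" using f(3) by blast
  obtain t2 where t2: "t2 \<ge> Suc t1" "G t2" using G by blast
  have T2: "T \<le> t2" "lv t2 = L" using t2 by (auto simp: G_def)
  obtain ev where ev: "fires t2 ev" using lv_pos[of t2] T2 L by auto
  have lev: "lev ev = L" using fires_lv[OF ev] T2 by simp
  have "prefix (stxt (run (Suc t1))) (etxt ev)" "set (key ev) \<subseteq> outs (stxt (run (Suc t1))) (etxt ev)"
    using inv[OF t1(1) t2(1)] ev by blast+
  then have "set (key ev) \<subseteq> S"
    using late_outs(1)[of G, OF f(2) S(1) t1(2) t2(2) ev] by blast
  \<comment> \<open>An event on an even level adds no entry if its list is already present; the
    older entry then takes its place.\<close>
  moreover obtain en where en: "en \<in> set (ents (run (Suc t2)))" "lev en = L" "key en = key ev"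
  proof (cases "\<exists>en\<in>set (ents (run t2)). lev en = lev ev \<and> key en = key ev")
    case True
    then obtain en where en: "en \<in> set (ents (run t2))" "lev en = lev ev" "key en = key ev" by blast
    then have "en \<in> set (ents (run (Suc t2)))" using persists[of t2 "Suc t2" en] T2 lev by simp
    then show ?thesis using that en lev by simp
  next
    case False
    then have "ev \<in> set (ents (run (Suc t2)))"
      using lev L_le cap_settled[OF T2(1)] unfolding fires_step[OF ev] ents_apply_event by simp
    then show ?thesis using that lev by blast
  qed
  ultimately have key: "set (key en) \<subseteq> S" by simp
  have w: "wf_entry (Suc t2) (run (Suc t2)) en" by (rule wf_entry_run[OF en(1)])
  have "key en \<noteq> []" using w en L by (auto simp: wf_entry_def)
  then have "length (key en) = Suc j" "\<forall>a\<in>set (tl (key en)). enum (Suc t2) a (val en)"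
    using w en L j by (auto simp: wf_entry_def)
  then obtain a b K where K: "key en = a # b # K" "enum (Suc t2) b (val en)"
    using j(2) by (cases "key en"; cases "tl (key en)") auto
  have "w a = w b" using K(1) key S(2) by simp
  then have "val en \<in> w a" using K(2) unfolding w_def by blast
  then obtain n where n: "\<forall>t\<ge>n. enum t a (val en)" using enum_eventually by blast
  have "\<forall>t\<ge>max n (Suc t2). trigger t (run t) (2, en, [], a)"
  proof (intro allI impI)
    fix t assume t: "t \<ge> max n (Suc t2)"
    have "en \<in> set (ents (run t))" using persists[of "Suc t2" t en] T2 t en by simp
    then show "trigger t (run t) (2, en, [], a)" using n t K L en by (simp add: trigger_def)
  qed
  from eventually_fires[OF this] obtain t where "t \<ge> Suc t2" "lv t = lev (event (run t) (2, en, [], a))" by auto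
  then show False using lv_settled[of t] T2 en by (simp add: event_def)
qed

end

lemma (in learned) fails: "\<exists>t j. \<not> learns (A t j)"
proof (rule ccontr)
  assume "\<not> (\<exists>t j. \<not> learns (A t j))"
  then have l: "learns (A t j)" for t j by blast
  then have "\<not> unsettled" using not_unsettled by blast
  then obtain T k L where "settled h e T k L" using settledI by blast
  then have "settled_learned h e T k L M"
    using l by (intro settled_learned.intro learned_axioms settled_learned_axioms.intro)
  then show False by (rule settled_learned.contradiction)
qed

section \<open>Computability of the construction\<close>

lemma cmp_entry [cmp_intros]:
  assumes "cmp f"
  shows "cmp (\<lambda>x. lev (f x))" "cmp (\<lambda>x. key (f x))" "cmp (\<lambda>x. val (f x))" "cmp (\<lambda>x. etxt (f x))"
  unfolding lev_def key_def val_def etxt_def by (intro cmp_intros assms)+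

lemma cmp_state [cmp_intros]:
  assumes "cmp f"
  shows "cmp (\<lambda>x. cap (f x))" "cmp (\<lambda>x. bnd (f x))" "cmp (\<lambda>x. stxt (f x))" "cmp (\<lambda>x. ents (f x))"
  unfolding cap_def bnd_def stxt_def ents_def by (intro cmp_intros assms)+

text \<open>Lets a definition be unfolded at the projections of a pair, so that the terms
  \<open>f x\<close> and \<open>g x\<close> are not duplicated.\<close>

lemma cmp_compose2:
  assumes "cmp (\<lambda>p. F (fst p) (snd p))" "cmp f" "cmp g"
  shows "cmp (\<lambda>x. F (f x) (g x))"
  using cmp_compose[OF assms(1) cmp_Pair[OF assms(2,3)]] by simp

lemma cmp_fresh [cmp_intros]: "cmp f \<Longrightarrow> cmp g \<Longrightarrow> cmp (\<lambda>x. fresh (f x) (g x))"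
  unfolding fresh_def by (intro cmp_intros)

lemma cmp_new_cap [cmp_intros]: "cmp f \<Longrightarrow> cmp g \<Longrightarrow> cmp (\<lambda>x. new_cap (f x) (g x))"
  unfolding new_cap_def by (intro cmp_intros)

lemma cmp_new_bnd [cmp_intros]: "cmp f \<Longrightarrow> cmp g \<Longrightarrow> cmp (\<lambda>x. new_bnd (f x) (g x))"
  unfolding new_bnd_def by (intro cmp_intros)

lemma cmp_new_ents [cmp_intros]: "cmp f \<Longrightarrow> cmp g \<Longrightarrow> cmp (\<lambda>x. new_ents (f x) (g x))"
  by (rule cmp_compose2) (unfold new_ents_def, intro cmp_intros)

lemma cmp_apply_event [cmp_intros]: "cmp f \<Longrightarrow> cmp g \<Longrightarrow> cmp (\<lambda>x. apply_event (f x) (g x))"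
  by (rule cmp_compose2) (unfold apply_event_def, intro cmp_intros)

lemma cmp_descr [cmp_intros]: "cmp f \<Longrightarrow> cmp (\<lambda>x. descr (f x))"
  unfolding descr_def by (intro cmp_inv_code surj_code_descr cmp_intros)

lemma cmp_column [cmp_intros]: "cmp f \<Longrightarrow> cmp g \<Longrightarrow> cmp (\<lambda>x. column (f x) (g x))"
  by (rule cmp_compose2) (unfold column_def, intro cmp_intros)

lemma cmp_event [cmp_intros]: "cmp f \<Longrightarrow> cmp g \<Longrightarrow> cmp (\<lambda>x. diag.event (f x) (g x))"
  by (rule cmp_compose2) (unfold diag.event_def case_prod_beta, intro cmp_intros)

lemma cmp_inQ [cmp_intros]:
  assumes "cmp f" "cmp g" shows "cmp (\<lambda>x. inQ (f x) (g x))"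
proof (rule cmp_compose2[OF _ assms])
  have eq: "inQ st y \<longleftrightarrow> y < bnd st \<and> \<not> (\<exists>en\<in>set (ents st). val en = y)" for st y
    by (auto simp: inQ_def vals_def)
  show "cmp (\<lambda>p. inQ (fst p) (snd p))" unfolding eq by (intro cmp_intros)
qed

lemma cmp_vals [cmp_intros]:
  assumes "cmp f" "cmp g" shows "cmp (\<lambda>x. g x \<in> vals (f x))"
proof (rule cmp_compose2[of "\<lambda>st y. y \<in> vals st", OF _ assms])
  have eq: "y \<in> vals st \<longleftrightarrow> (\<exists>en\<in>set (ents st). val en = y)" for st y
    by (auto simp: vals_def)
  show "cmp (\<lambda>p. snd p \<in> vals (fst p))" unfolding eq by (intro cmp_intros)
qed

lemma cmp_zvals [cmp_intros]:
  assumes "cmp f" "cmp g" "cmp l" shows "cmp (\<lambda>x. g x \<in> zvals (f x) (l x))"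
proof -
  have eq: "y \<in> zvals st n \<longleftrightarrow> (\<exists>en\<in>set (ents st). lev en = n \<and> key en = [] \<and> val en = y)" for st y n
    unfolding zvals_def by blast
  have "cmp (\<lambda>p. fst (snd p) \<in> zvals (fst p) (snd (snd p)))" unfolding eq by (intro cmp_intros)
  from cmp_compose[OF this, of "\<lambda>x. (f x, g x, l x)"] show ?thesis using assms by (simp add: cmp_Pair)
qed

context
  fixes h :: "nat \<Rightarrow> nat"
  assumes h: "computable h"
begin

lemma cmp_wit: "cmp t \<Longrightarrow> cmp y \<Longrightarrow> cmp (\<lambda>x. diag.wit h (t x) (y x))"
  by (rule cmp_compose2) (unfold diag.wit_def, intro cmp_intros cmp_computable[OF h])

lemma cmp_guess:
  "cmp e \<Longrightarrow> cmp t \<Longrightarrow> cmp s \<Longrightarrow> cmp a \<Longrightarrow> cmp (\<lambda>x. diag.guess h (e x) (t x) (s x) (a x))"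
  unfolding diag.guess_def by (intro cmp_wit cmp_intros)

lemma cmp_enum:
  "cmp e \<Longrightarrow> cmp t \<Longrightarrow> cmp a \<Longrightarrow> cmp y \<Longrightarrow> cmp (\<lambda>x. diag.enum h (e x) (t x) (a x) (y x))"
  unfolding diag.enum_def by (intro cmp_wit cmp_intros)

lemma cmp_trigger:
  assumes "cmp e" "cmp t" "cmp st" "cmp d"
  shows "cmp (\<lambda>x. diag.trigger h (e x) (t x) (st x) (d x))"
proof -
  have "cmp (\<lambda>p. diag.trigger h (fst p) (fst (snd p)) (fst (snd (snd p))) (snd (snd (snd p))))"
    unfolding diag.trigger_def case_prod_beta by (intro cmp_guess cmp_enum cmp_intros)
  from cmp_compose[OF this, of "\<lambda>x. (e x, t x, st x, d x)"] show ?thesis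
    using assms by (simp add: cmp_Pair)
qed

lemma cmp_step:
  "cmp e \<Longrightarrow> cmp t \<Longrightarrow> cmp st \<Longrightarrow> cmp (\<lambda>x. diag.step h (e x) (t x) (st x))"
  unfolding diag.step_def by (intro cmp_trigger cmp_intros)

lemma cmp_run: "cmp e \<Longrightarrow> cmp t \<Longrightarrow> cmp (\<lambda>x. diag.run h (e x) (t x))"
  by (rule cmp_compose2) (unfold diag.run_def, intro cmp_step cmp_intros)

lemma cmp_lv: "cmp e \<Longrightarrow> cmp t \<Longrightarrow> cmp (\<lambda>x. diag.lv h (e x) (t x))"
  unfolding diag.lv_def by (intro cmp_trigger cmp_run cmp_intros)

lemma cmp_alive:
  assumes "cmp e" "cmp t0" "cmp j" "cmp t"
  shows "cmp (\<lambda>x. diag.alive h (e x) (t0 x) (j x) (t x))"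
proof -
  have eq: "diag.alive h e t0 j t \<longleftrightarrow> j \<le> cap (diag.run h e t0) \<and>
    (\<forall>u<t. \<not> t0 \<le> u \<or> diag.lv h e u \<le> 2 * j)" for e t0 j t
    unfolding diag.alive_def by blast
  have "cmp (\<lambda>p. diag.alive h (fst p) (fst (snd p)) (fst (snd (snd p))) (snd (snd (snd p))))"
    unfolding eq by (intro cmp_run cmp_lv cmp_intros)
  from cmp_compose[OF this, of "\<lambda>x. (e x, t0 x, j x, t x)"] show ?thesis
    using assms by (simp add: cmp_Pair)
qed

lemma cmp_member:
  assumes "cmp e" "cmp t0" "cmp j" "cmp t" "cmp y"
  shows "cmp (\<lambda>x. diag.member h (e x) (t0 x) (j x) (t x) (y x))"
  unfolding diag.member_def by (intro cmp_run cmp_alive cmp_intros assms)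

end

lemma uniformly_ce_seqI:
  assumes "cmp (\<lambda>p :: (nat \<times> nat) \<times> nat. P (fst (fst p)) (snd (fst p)) (snd p))"
  shows "uniformly_ce_seq (\<lambda>e. {x. \<exists>t. P e x t})"
proof -
  have "ce {c. \<exists>t. P (fst (prod_decode c)) (snd (prod_decode c)) t}"
    by (rule ce_Ex, rule cmp_compose[OF assms, of "\<lambda>p. (prod_decode (fst p), snd p)", simplified])
      (intro cmp_intros)
  moreover have "{c. \<exists>t. P (fst (prod_decode c)) (snd (prod_decode c)) t} =
      {prod_encode (e, x) | e x. x \<in> {x. \<exists>t. P e x t}}"
    by (auto intro: exI[of _ "fst (prod_decode c)" for c]) (metis prod.collapse prod_decode_inverse)
  ultimately show ?thesis unfolding uniformly_ce_seq_def by simp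
qed

lemma code_nat_list: "code (s :: nat list) = list_encode s"
  by (simp add: code_list_def map_idI)

section \<open>The separation\<close>

lemma separation:
  fixes W :: "nat \<Rightarrow> nat set"
  assumes acc: "acceptable_numbering W"
  shows "\<exists>L. uniformly_ce_family W L \<and> L \<in> TxtFex W \<infinity> 2 \<and> L \<notin> TxtFext W \<infinity> \<infinity>"
proof -
  have range_W: "range W = {A. ce A}" and univ: "uniformly_ce_seq W"
    and transl: "\<And>V. uniformly_ce_seq V \<Longrightarrow> \<exists>g. computable g \<and> (\<forall>e. V e = W (g e))"
    using acc unfolding acceptable_numbering_def by blast+
  \<comment> \<open>An index of \<open>UNIV\<close> shows that the set of pairs is nonempty, hence
    the range of a computable function \<open>h\<close>.\<close>
  have "ce UNIV" unfolding ce_def using computable_id by (auto intro!: exI[of _ "\<lambda>x. x"])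
  then obtain e1 where "W e1 = UNIV" using range_W by (metis (mono_tags) imageE mem_Collect_eq)
  then have "{prod_encode (e, x) | e x. x \<in> W e} \<noteq> {}" by auto
  then obtain h where h: "computable h" "{prod_encode (e, x) | e x. x \<in> W e} = range h"
    using univ unfolding uniformly_ce_seq_def ce_def by auto
  have h_iff: "(\<exists>u. h u = prod_encode (e, x)) \<longleftrightarrow> x \<in> W e" for e x
  proof -
    have "(\<exists>u. h u = prod_encode (e, x)) \<longleftrightarrow> prod_encode (e, x) \<in> {prod_encode (e, x) | e x. x \<in> W e}"
      unfolding h(2) by (metis rangeE rangeI)
    then show ?thesis by (auto simp: prod_encode_eq)
  qed
  define col where "col e B = (\<lambda>y. prod_encode (e, y)) ` B" for e and B :: "nat set"
  have in_col: "x \<in> col e B \<longleftrightarrow> fst (prod_decode x) = e \<and> snd (prod_decode x) \<in> B" for x e B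
    unfolding col_def by (auto simp: image_iff) (metis prod.collapse prod_decode_inverse)
  have "uniformly_ce_seq (\<lambda>e. {x. \<exists>t::nat. fst (prod_decode x) = e})"
    by (rule uniformly_ce_seqI) (intro cmp_intros)
  then obtain gp where gp: "computable gp" "\<And>e. W (gp e) = col e UNIV"
    using transl[of "\<lambda>e. {x. \<exists>t::nat. fst (prod_decode x) = e}"] in_col by fastforce
  have "uniformly_ce_seq (\<lambda>e. {x. \<exists>t. fst (prod_decode x) = e \<and> inQ (diag.run h e t) (snd (prod_decode x))})"
    by (rule uniformly_ce_seqI) (intro cmp_run[OF h(1)] cmp_intros)
  then obtain gq where "computable gq"
    "\<And>e. {x. \<exists>t. fst (prod_decode x) = e \<and> inQ (diag.run h e t) (snd (prod_decode x))} = W (gq e)"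
    using transl by fastforce
  moreover have "{x. \<exists>t. fst (prod_decode x) = e \<and> inQ (diag.run h e t) (snd (prod_decode x))} = col e (diag.Q h e)" for e
    by (auto simp: in_col diag.Q_def)
  ultimately have gq: "computable gq" "\<And>e. W (gq e) = col e (diag.Q h e)" by auto
  \<comment> \<open>\<open>n\<close> codes a column, a starting time and a search number
    \<open>j\<close>.\<close>
  define V where "V n = col (fst (prod_decode n)) (diag.A h (fst (prod_decode n))
     (fst (prod_decode (snd (prod_decode n)))) (snd (prod_decode (snd (prod_decode n)))))" for n
  have V_eq: "V n = {x. \<exists>t. fst (prod_decode x) = fst (prod_decode n) \<and> fst (prod_decode (snd (prod_decode n))) \<le> t \<and>
      diag.member h (fst (prod_decode n)) (fst (prod_decode (snd (prod_decode n))))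
        (snd (prod_decode (snd (prod_decode n)))) t (snd (prod_decode x))}" for n
    by (auto simp: V_def in_col diag.A_def)
  have "uniformly_ce_seq V" unfolding V_eq
    by (rule uniformly_ce_seqI) (intro cmp_member[OF h(1)] cmp_intros)
  then obtain gA where gA: "computable gA" "\<And>n. V n = W (gA n)" using transl by blast
  define L where "L = {W (gA n) | n. True}"
  have L_ce: "\<forall>A\<in>L. ce A" using range_W unfolding L_def by blast
  have V_L: "col e (diag.A h e t j) \<in> L" for e t j
  proof -
    have "V (prod_encode (e, prod_encode (t, j))) = col e (diag.A h e t j)" by (simp add: V_def)
    then show ?thesis unfolding L_def using gA(2) by (metis (mono_tags) mem_Collect_eq)
  qed
  have L_V: "\<exists>e t j. B = col e (diag.A h e t j)" if BL: "B \<in> L" for B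
  proof -
    obtain n where "B = V n" using BL gA(2) unfolding L_def by auto
    then show ?thesis unfolding V_def by blast
  qed

  \<comment> \<open>The column is read off the first datum, and the length of the data is the time
    at which the run is inspected. The default 0 concerns only the empty string.\<close>
  define N where "N s = (if \<exists>en\<in>set (ents (diag.run h (fst (prod_decode (hd_or 0 s))) (length s))).
      key en = [] \<and> prod_encode (fst (prod_decode (hd_or 0 s)), val en) \<in> set s
    then gq (fst (prod_decode (hd_or 0 s))) else gp (fst (prod_decode (hd_or 0 s))))" for s
  have "cmp N" unfolding N_def
    by (intro cmp_run[OF h(1)] cmp_computable[OF gp(1)] cmp_computable[OF gq(1)] cmp_intros)
  then have N: "learner N" unfolding learner_def cmp_def by (auto simp: code_nat_list)

  have N_ident: "TxtFex_identifies W \<infinity> 2 N f" if f: "content f = col e (diag.A h e t j)" for f e t j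
  proof -
    define f' where "f' i = snd (prod_decode (f i))" for i
    have f_col: "f i \<in> col e (diag.A h e t j)" for i using f by (auto simp: content_def)
    have ff': "f i = prod_encode (e, f' i)" for i
      using f_col[of i] unfolding in_col f'_def by (metis prod.collapse prod_decode_inverse)
    have "range f' = diag.A h e t j"
    proof
      show "range f' \<subseteq> diag.A h e t j" using f_col unfolding in_col f'_def by auto
      show "diag.A h e t j \<subseteq> range f'"
      proof
        fix y assume "y \<in> diag.A h e t j"
        then have "prod_encode (e, y) \<in> range f" using f by (simp add: in_col content_def)
        then obtain i where "f i = prod_encode (e, y)" by (metis rangeE)
        then have "y = f' i" by (simp add: f'_def)
        then show "y \<in> range f'" by blast
      qed
    qed
    note vac = diag.vacillation[OF this]
    have N_eq: "N (init_seg f n) = (if diag.zhit h e n (f' ` {..<n}) then gq e else gp e)" if n: "n \<ge> 1" for n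
    proof -
      have "[0..<n] = 0 # [1..<n]" using n by (simp add: upt_conv_Cons)
      then have "hd_or 0 (init_seg f n) = f 0" by (simp add: init_seg_def hd_or_def)
      then have e: "fst (prod_decode (hd_or 0 (init_seg f n))) = e" by (simp add: ff')
      have "prod_encode (e, y) \<in> set (init_seg f n) \<longleftrightarrow> y \<in> f' ` {..<n}" for y
        by (auto simp: init_seg_def ff' prod_encode_eq)
      then show ?thesis unfolding N_def e diag.zhit_def by (simp add: init_seg_def)
    qed
    have var: "variant_eq \<infinity> (col e B) (content f)"
      if "finite (B - diag.A h e t j)" "finite (diag.A h e t j - B)" for B
    proof -
      have "(col e B - content f) \<union> (content f - col e B) =
          col e ((B - diag.A h e t j) \<union> (diag.A h e t j - B))"
        unfolding f by (auto simp: in_col)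
      moreover have "finite (col e ((B - diag.A h e t j) \<union> (diag.A h e t j - B)))"
        using that unfolding col_def by simp
      ultimately show ?thesis unfolding variant_eq_def by simp
    qed
    have p: "variant_eq \<infinity> (W (gp e)) (content f)" if "finite (- diag.A h e t j)"
      unfolding gp(2) by (rule var) (use that in \<open>simp_all add: Compl_eq_Diff_UNIV\<close>)
    have q: "variant_eq \<infinity> (W (gq e)) (content f)" if "finite (diag.A h e t j - diag.Q h e)"
    proof -
      have "diag.Q h e - diag.A h e t j = {}" using diag.Q_subset_A by blast
      then have "finite (diag.Q h e - diag.A h e t j)" by (simp only: finite.emptyI)
      then show ?thesis unfolding gq(2) using that by (rule var)
    qed
    have ident: "TxtFex_identifies W \<infinity> 2 N f"
      if "S \<subseteq> {gp e, gq e}" "\<forall>n\<ge>n0. N (init_seg f n) \<in> S" "\<forall>a\<in>S. variant_eq \<infinity> (W a) (content f)" for S n0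
    proof -
      have "card S \<le> card {gp e, gq e}" by (rule card_mono[OF _ that(1)]) simp
      also have "\<dots> \<le> 2" by (simp add: card_insert_if)
      finally have "enat (card S) \<le> 2" by (simp add: numeral_eq_enat)
      moreover have "\<forall>\<^sub>\<infinity>n. N (init_seg f n) \<in> S" using that(2) unfolding MOST_nat_le by blast
      moreover have "finite S" by (rule finite_subset[OF that(1)]) simp
      ultimately show ?thesis unfolding TxtFex_identifies_def using that(3) by blast
    qed
    from vac show ?thesis
    proof (elim disjE conjE exE)
      assume 1: "finite (- diag.A h e t j)" "finite (- diag.Q h e)"
      have "finite (diag.A h e t j - diag.Q h e)" by (rule finite_subset[OF _ 1(2)]) blast
      then show ?thesis using p q 1 N_eq by (intro ident[of "{gp e, gq e}" 1]) auto
    next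
      fix n0 assume 2: "\<forall>n\<ge>n0. diag.zhit h e n (f' ` {..<n})" "finite (diag.A h e t j - diag.Q h e)"
      then show ?thesis using q N_eq by (intro ident[of "{gq e}" "max 1 n0"]) auto
    next
      fix n0 assume 3: "\<forall>n\<ge>n0. \<not> diag.zhit h e n (f' ` {..<n})" "finite (- diag.A h e t j)"
      then show ?thesis using p N_eq by (intro ident[of "{gp e}" "max 1 n0"]) auto
    qed
  qed
  have "\<forall>A\<in>L. \<forall>f. content f = A \<longrightarrow> TxtFex_identifies W \<infinity> 2 N f" using L_V N_ident by metis
  then have Fex: "L \<in> TxtFex W \<infinity> 2" unfolding TxtFex_def using L_ce N by blast

  have "L \<notin> TxtFext W \<infinity> \<infinity>"
  proof
    assume "L \<in> TxtFext W \<infinity> \<infinity>"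
    then obtain M where M: "learner M"
      "\<And>B f. B \<in> L \<Longrightarrow> content f = B \<Longrightarrow> TxtFext_identifies W \<infinity> \<infinity> M f"
      unfolding TxtFext_def by blast
    obtain m where m: "computable m" "\<And>s. M s = m (list_encode s)" using M(1) unfolding learner_def by blast
    have "cmp (\<lambda>c. prod_encode (c, m c))" by (intro cmp_intros cmp_computable[OF m(1)])
    then have "ce (range (\<lambda>c. prod_encode (c, m c)))" unfolding ce_def cmp_nat_iff by blast
    \<comment> \<open>The column number is an index of the graph of the learner, so that the
      construction in this column works against \<open>M\<close>.\<close>
    then obtain e where e: "W e = range (\<lambda>c. prod_encode (c, m c))"
      using range_W by (metis (mono_tags) imageE mem_Collect_eq)
    interpret learned h e "\<lambda>s. M (column e s)"
    proof
      fix s a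
      have "(\<exists>t. diag.guess h e t s a) \<longleftrightarrow> (\<exists>u. h u = prod_encode (e, prod_encode (code (column e s), a)))"
        unfolding diag.guess_def diag.wit_def by blast
      also have "\<dots> \<longleftrightarrow> prod_encode (code (column e s), a) \<in> W e" by (rule h_iff)
      also have "\<dots> \<longleftrightarrow> a = M (column e s)"
        unfolding e by (auto simp: prod_encode_eq m(2) code_nat_list)
      finally show "(\<exists>t. diag.guess h e t s a) \<longleftrightarrow> a = M (column e s)" .
    qed
    have w_eq: "w a = {x. prod_encode (e, x) \<in> W a}" for a
      unfolding w_def enum_def wit_def using h_iff by blast
    have "learns (A t j)" for t j
      unfolding learns_def
    proof (intro allI impI)
      fix f' :: "nat \<Rightarrow> nat" assume f': "range f' = A t j"
      define f where "f i = prod_encode (e, f' i)" for i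
      have cf: "content f = col e (A t j)" unfolding content_def f_def col_def f'[symmetric] by auto
      have seg: "init_seg f n = column e (map f' [0..<n])" for n
        by (simp add: init_seg_def column_def f_def)
      have "TxtFext_identifies W \<infinity> \<infinity> M f" by (rule M(2)[OF V_L cf])
      then obtain S where S: "finite S" "\<forall>\<^sub>\<infinity>n. M (init_seg f n) \<in> S"
        "\<And>a b. a \<in> S \<Longrightarrow> b \<in> S \<Longrightarrow> W a = W b \<and> variant_eq \<infinity> (W b) (content f)"
        unfolding TxtFext_identifies_def by blast
      obtain n0 where n0: "\<forall>n\<ge>n0. M (init_seg f n) \<in> S" using S(2) unfolding MOST_nat_le by blast
      have fin: "finite (w a - A t j) \<and> finite (A t j - w a)" if "a \<in> S" for a
      proof -
        have "finite ((W a - content f) \<union> (content f - W a))" using S(3)[OF that that] unfolding variant_eq_def by blast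
        then have fin: "finite (W a - content f)" "finite (content f - W a)" by auto
        have inj: "inj_on (\<lambda>y. prod_encode (e, y)) B" for B by (auto simp: inj_on_def prod_encode_eq)
        have "(\<lambda>y. prod_encode (e, y)) ` (w a - A t j) \<subseteq> W a - content f"
          "(\<lambda>y. prod_encode (e, y)) ` (A t j - w a) \<subseteq> content f - W a"
          unfolding w_eq cf by (auto simp: in_col)
        then have "finite ((\<lambda>y. prod_encode (e, y)) ` (w a - A t j))"
          "finite ((\<lambda>y. prod_encode (e, y)) ` (A t j - w a))"
          using fin finite_subset by blast+
        then show ?thesis using finite_imageD[OF _ inj] by blast
      qed
      have ww: "w a = w b" if "a \<in> S" "b \<in> S" for a b using S(3)[OF that] unfolding w_eq by simp
      show "\<exists>S n0. finite S \<and> (\<forall>n\<ge>n0. M (column e (map f' [0..<n])) \<in> S) \<and>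
          (\<forall>a\<in>S. \<forall>b\<in>S. w a = w b) \<and> (\<forall>a\<in>S. finite (w a - A t j) \<and> finite (A t j - w a))"
        by (intro exI[of _ S] exI[of _ n0] conjI ballI) (use S(1) n0[unfolded seg] fin ww in blast)+
    qed
    then show False using fails by blast
  qed
  moreover have "uniformly_ce_family W L" unfolding uniformly_ce_family_def L_def using gA(1) by blast
  ultimately show ?thesis using Fex by blast
qed

theorem theorem2p1:
  fixes W :: "nat \<Rightarrow> nat set"
  assumes "acceptable_numbering W"
  shows "(\<exists>L. uniformly_ce_family W L \<and> L \<in> TxtFex W \<infinity> 2 \<and> L \<notin> TxtFext W \<infinity> \<infinity>) \<and>
         TxtFex W \<infinity> \<infinity> \<noteq> TxtFext W \<infinity> \<infinity>"
proof -
  obtain L where L: "uniformly_ce_family W L" "L \<in> TxtFex W \<infinity> 2" "L \<notin> TxtFext W \<infinity> \<infinity>"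
    using separation[OF assms] by blast
  have weaken: "TxtFex_identifies W \<infinity> \<infinity> M f" if "TxtFex_identifies W \<infinity> 2 M f" for M f
    using that unfolding TxtFex_identifies_def by (metis enat_ord_code(3))
  obtain M where "\<forall>A\<in>L. ce A" "learner M"
    "\<And>A f. A \<in> L \<Longrightarrow> content f = A \<Longrightarrow> TxtFex_identifies W \<infinity> 2 M f"
    using L(2) unfolding TxtFex_def by blast
  then have "L \<in> TxtFex W \<infinity> \<infinity>" unfolding TxtFex_def mem_Collect_eq
    by (intro conjI exI[of _ M]) (use weaken in simp_all)
  with L show ?thesis by metis
qed

end
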